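(* For every $i\ge0$: $\nu(Z_{i,1}(d_{i,1}))=0$; $$\nu(Z_{i,1}(d_{i,1}+1))\ \begin{cases}=1,& i\equiv 1\pmod 4,\\ \ge 2,& i\not\equiv 1\pmod 4;\end{cases}$$ and for every $M\ge2$, $\nu(Z_{i,1}(d_{i,1}+M))\ge M+1$.
   Context: Let $E(q)=\prod_{m\ge1}(1-q^m)$. Define $$\gamma(q)=\frac{E(q)^5E(q^2)^5E(q^6)^5}{E(q^3)^{15}},\quad \xi=\xi(q)=\frac{E(q^2)^5E(q^6)}{E(q)E(q^3)^5},\quad \kappa(q)=\frac{\gamma(q^2)^2}{\gamma(q)},$$ and let $U\left(\sum_n a_nq^n\right)=\sum_n a_{2n}q^n$. For $i,j\ge0$, $\zeta_{i,j}=U(\kappa^i\xi^j)$, which equals a polynomial in $\xi$ with integer coefficients; write $\zeta_{i,j}=\sum_m Z_{i,j}(m)\xi^m$. Define $d_{i,j}=5I+J$ if $(i,j)=(2I,2J)$; $5I+J+1$ if $(i,j)=(2I,2J+1)$; $5I+J+3$ if $(i,j)=(2I+1,2J)$ or $(2I+1,2J+1)$. $\nu(n)$ is the $2$-adic valuation of an integer $n$, with $\nu(0)=\infty$. *)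

theory Defs
  imports "HOL-Computational_Algebra.Computational_Algebra" "HOL-Library.Extended_Nat"
begin

text \<open>All q-series are formal power series with rational coefficients
(all of them actually have integer coefficients; rationals are used so that
division of series with constant term 1 is available).\<close>

text \<open>E(q) = prod_{m>=1} (1 - q^m), as a formal power series: its n-th coefficient
equals the n-th coefficient of the finite product over m = 1..n.\<close>
definition E_fps :: "rat fps" where
  "E_fps = Abs_fps (\<lambda>n. (\<Prod>m\<in>{1..n}. (1 - fps_X ^ m :: rat fps)) $ n)"

definition dil :: "nat \<Rightarrow> rat fps \<Rightarrow> rat fps" where
  "dil k f = Abs_fps (\<lambda>n. if k dvd n then f $ (n div k) else 0)"

definition E :: "nat \<Rightarrow> rat fps" where
  "E k = dil k E_fps"

definition gamma_fps :: "rat fps" where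
  "gamma_fps = E 1 ^ 5 * E 2 ^ 5 * E 6 ^ 5 / E 3 ^ 15"

definition xi_fps :: "rat fps" where
  "xi_fps = E 2 ^ 5 * E 6 / (E 1 * E 3 ^ 5)"

definition kappa_fps :: "rat fps" where
  "kappa_fps = (dil 2 gamma_fps) ^ 2 / gamma_fps"

definition U :: "rat fps \<Rightarrow> rat fps" where
  "U f = Abs_fps (\<lambda>n. f $ (2 * n))"

definition zeta :: "nat \<Rightarrow> nat \<Rightarrow> rat fps" where
  "zeta i j = U (kappa_fps ^ i * xi_fps ^ j)"

definition poly_in_xi :: "int poly \<Rightarrow> rat fps" where
  "poly_in_xi p = (\<Sum>m\<le>degree p. fps_const (of_int (coeff p m)) * xi_fps ^ m)"

definition Z :: "nat \<Rightarrow> nat \<Rightarrow> nat \<Rightarrow> int" where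
  "Z i j m = coeff (THE p. zeta i j = poly_in_xi p) m"

definition d :: "nat \<Rightarrow> nat \<Rightarrow> nat" where
  "d i j = 5 * (i div 2) + j div 2 +
     (if even i then (if even j then 0 else 1) else 3)"

definition nu :: "int \<Rightarrow> enat" where
  "nu n = (if n = 0 then \<infinity> else enat (multiplicity (2::int) n))"

end

theory Submission
  imports Defs
begin

text \<open>Put \<open>s = q E(q\<^sup>2)\<^sup>2 E(q\<^sup>1\<^sup>2)\<^sup>4 / (E(q\<^sup>4)\<^sup>4 E(q\<^sup>6)\<^sup>2)\<close>, an odd series. Then
  \<open>\<xi>(q) = (1 + 3s) / (1 + s)\<^sup>2\<close>, \<open>\<xi>(q\<^sup>2) = 1 / (1 - s\<^sup>2)\<close> and \<open>\<kappa>(q) = (\<xi>(q\<^sup>2) (1 + s))\<^sup>5\<close>, so that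
  \<open>\<zeta>\<^sub>i\<^sub>,\<^sub>1\<close> is \<open>\<xi>\<^sup>5\<^sup>i\<close> times the part of \<open>(1 + s)\<^sup>n (1 + 3s)\<close>, \<open>n = 5i - 2\<close>, that is even in \<open>s\<close>,
  expressed through \<open>s\<^sup>2 = 1 - 1/\<xi>\<close>. These even parts satisfy
  \<open>a\<^sub>n\<^sub>+\<^sub>2 = 2 a\<^sub>n\<^sub>+\<^sub>1 - a\<^sub>n / \<xi>\<close>, and the 2-adic bounds follow by induction on \<open>n\<close>.

  The product formulas for \<open>1 + s\<close>, \<open>1 - s\<close> and \<open>1 + 3s\<close> are instances of one identity between
  squares of theta series,
  \<open>A(z)\<^sup>2 + (P/z) B(z)\<^sup>2 = (\<Sum>k. (-P)^(k^2)) (\<Sum>k. z^k P^(k^2))\<close> with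
  \<open>A(z) = (\<Sum>n. (-z)^n P^(2n^2))\<close> and \<open>B(z) = (\<Sum>n. (-z)^n P^(2n^2-2n))\<close>, at
  \<open>(z, P) = (q\<^sup>2, q\<^sup>3)\<close>, \<open>(q\<^sup>2, -q\<^sup>3)\<close> and \<open>(w, -q)\<close> with a primitive cube root of unity \<open>w\<close>;
  the Jacobi triple product turns the theta series into products.\<close>

subsection \<open>Infinite products of formal power series\<close>

text \<open>Agreement of two series below degree \<open>n\<close> is treated as divisibility of
  their difference by \<open>fps_X ^ n\<close>, so that estimates combine by the rules for
  \<open>dvd\<close>.\<close>

lemma X_power_dvd_iff:
  fixes f :: "'a::field fps"
  shows "fps_X ^ n dvd f \<longleftrightarrow> (\<forall>i<n. f $ i = 0)"
proof
  assume "fps_X ^ n dvd f"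
  then obtain g where "f = fps_X ^ n * g" by (elim dvdE)
  then show "\<forall>i<n. f $ i = 0" by (simp add: fps_X_power_mult_nth)
next
  assume "\<forall>i<n. f $ i = 0"
  then have "f = fps_X ^ n * fps_shift n f"
    by (intro fps_ext) (simp add: fps_X_power_mult_nth)
  then show "fps_X ^ n dvd f" by (metis dvd_triv_left)
qed

lemma X_power_dvd_power:
  fixes c :: "'a::field fps"
  assumes "c $ 0 = 0" "m \<le> n"
  shows "fps_X ^ m dvd c ^ n"
proof -
  have "fps_X dvd c" using X_power_dvd_iff[of 1 c] assms(1) by simp
  then show ?thesis using assms(2) by (meson dvd_power_same dvd_trans le_imp_power_dvd)
qed

lemma tendsto_mult_fps:
  fixes f g :: "'b \<Rightarrow> 'a::field fps"
  assumes "(f \<longlongrightarrow> a) F" "(g \<longlongrightarrow> b) F"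
  shows "((\<lambda>x. f x * g x) \<longlongrightarrow> a * b) F"
  unfolding tendsto_fps_iff
proof
  fix n
  have "\<forall>\<^sub>F x in F. \<forall>k\<in>{..n}. f x $ k = a $ k" "\<forall>\<^sub>F x in F. \<forall>k\<in>{..n}. g x $ k = b $ k"
    using assms unfolding tendsto_fps_iff by (simp_all add: eventually_ball_finite)
  then show "\<forall>\<^sub>F x in F. (f x * g x) $ n = (a * b) $ n"
    by eventually_elim (auto simp: fps_mult_nth intro!: sum.cong)
qed

lemma tendsto_prod_fps:
  fixes f :: "'i \<Rightarrow> 'b \<Rightarrow> 'a::field fps"
  assumes "\<And>i. i \<in> I \<Longrightarrow> (f i \<longlongrightarrow> a i) F"
  shows "((\<lambda>x. \<Prod>i\<in>I. f i x) \<longlongrightarrow> (\<Prod>i\<in>I. a i)) F"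
  using assms by (induction I rule: infinite_finite_induct) (auto intro!: tendsto_mult_fps)

text \<open>In q-Pochhammer notation this is (-a; c)_n.\<close>

definition qpoch_fin :: "'a::field fps \<Rightarrow> 'a fps \<Rightarrow> nat \<Rightarrow> 'a fps" where
  "qpoch_fin a c n = (\<Prod>i<n. 1 + a * c ^ i)"

text \<open>If \<open>c\<close> has constant term 0, the factors after the first
  \<open>n + 1\<close> are 1 modulo \<open>fps_X ^ (n + 1)\<close>, so coefficient \<open>n\<close>
  is final by then.\<close>

definition qpoch :: "'a::field fps \<Rightarrow> 'a fps \<Rightarrow> 'a fps" where
  "qpoch a c = Abs_fps (\<lambda>n. qpoch_fin a c (Suc n) $ n)"

lemma qpoch_fin_Suc: "qpoch_fin a c (Suc n) = qpoch_fin a c n * (1 + a * c ^ n)"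
  by (simp add: qpoch_fin_def)

lemma qpoch_fin_cong:
  assumes "c $ 0 = 0" "n \<le> m"
  shows "fps_X ^ n dvd qpoch_fin a c m - qpoch_fin a c n"
  using assms(2)
proof (induction m rule: dec_induct)
  case (step m)
  have "qpoch_fin a c (Suc m) - qpoch_fin a c n
      = qpoch_fin a c m - qpoch_fin a c n + qpoch_fin a c m * a * c ^ m"
    by (simp add: qpoch_fin_Suc algebra_simps)
  then show ?case
    using step X_power_dvd_power[OF assms(1) step(1)] by (metis dvd_add dvd_mult)
qed simp

lemma qpoch_cong:
  assumes "c $ 0 = 0" "n \<le> m"
  shows "fps_X ^ n dvd qpoch_fin a c m - qpoch a c"
  unfolding X_power_dvd_iff
proof (intro allI impI)
  fix i assume "i < n"
  then have "fps_X ^ Suc i dvd qpoch_fin a c m - qpoch_fin a c (Suc i)"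
    using assms by (intro qpoch_fin_cong) auto
  then show "(qpoch_fin a c m - qpoch a c) $ i = 0"
    by (simp add: X_power_dvd_iff qpoch_def del: power_Suc)
qed

lemma qpoch_LIMSEQ:
  assumes "c $ 0 = 0"
  shows "qpoch_fin a c \<longlonglongrightarrow> qpoch a c"
proof (rule tendsto_fpsI)
  fix n
  have "qpoch_fin a c m $ n = qpoch a c $ n" if "m \<ge> Suc n" for m
    using qpoch_cong[OF assms that, of a] by (simp add: X_power_dvd_iff del: power_Suc)
  then show "\<forall>\<^sub>F m in sequentially. qpoch_fin a c m $ n = qpoch a c $ n"
    unfolding eventually_sequentially by blast
qed

lemma qpoch_eqI:
  assumes "c $ 0 = 0" "qpoch_fin a c \<longlonglongrightarrow> f"
  shows "qpoch a c = f"
  using qpoch_LIMSEQ[OF assms(1)] assms(2) by (rule LIMSEQ_unique)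

lemma qpoch_nth_0 [simp]: "c $ 0 = 0 \<Longrightarrow> qpoch a c $ 0 = 1 + a $ 0"
  by (simp add: qpoch_def qpoch_fin_def)

lemma qpoch_mult_minus:
  assumes "c $ 0 = 0"
  shows "qpoch a c * qpoch (- a) c = qpoch (- (a\<^sup>2)) (c\<^sup>2)"
proof -
  have "qpoch_fin (- (a\<^sup>2)) (c\<^sup>2) = (\<lambda>n. qpoch_fin a c n * qpoch_fin (- a) c n)"
    unfolding qpoch_fin_def prod.distrib [symmetric]
    by (intro ext prod.cong) (simp_all add: algebra_simps power2_eq_square power_mult_distrib)
  moreover have "(\<lambda>n. qpoch_fin a c n * qpoch_fin (- a) c n) \<longlonglongrightarrow> qpoch a c * qpoch (- a) c"
    using assms by (intro tendsto_mult_fps qpoch_LIMSEQ)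
  ultimately show ?thesis
    using qpoch_eqI[of "c\<^sup>2" "- (a\<^sup>2)"] assms by (simp add: fps_power_zeroth)
qed

text \<open>Factor by factor this is
  \<open>(1 + t) * (1 + w * t) * (1 + w\<^sup>2 * t) = 1 + t ^ 3\<close>.\<close>

lemma qpoch_mult_cube_roots:
  assumes "c $ 0 = 0" and w: "1 + w + w\<^sup>2 = (0 :: 'a::field fps)"
  shows "qpoch a c * qpoch (w * a) c * qpoch (w\<^sup>2 * a) c = qpoch (a ^ 3) (c ^ 3)"
proof -
  have w2: "w\<^sup>2 = - 1 - w" using w by (simp add: algebra_simps eq_neg_iff_add_eq_0)
  have w3: "w * w\<^sup>2 = 1"
  proof -
    have "w * w\<^sup>2 - 1 = (w - 1) * (1 + w + w\<^sup>2)" by (simp add: algebra_simps power2_eq_square)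
    then show ?thesis using w by simp
  qed
  have *: "(1 + t) * (1 + w * t) * (1 + w\<^sup>2 * t) = 1 + t ^ 3" for t :: "'a fps"
  proof -
    have "(1 + t) * (1 + w * t) * (1 + w\<^sup>2 * t)
        = 1 + (1 + w + w\<^sup>2) * t + w * (1 + w + w\<^sup>2) * t\<^sup>2 + (w * w\<^sup>2) * t ^ 3"
      by (simp add: algebra_simps power2_eq_square power3_eq_cube)
    then show ?thesis using w w3 by simp
  qed
  have "qpoch_fin (a ^ 3) (c ^ 3)
      = (\<lambda>n. qpoch_fin a c n * qpoch_fin (w * a) c n * qpoch_fin (w\<^sup>2 * a) c n)"
    unfolding qpoch_fin_def prod.distrib [symmetric]
  proof (intro ext prod.cong refl)
    fix i :: nat
    show "1 + a ^ 3 * (c ^ 3) ^ i = (1 + a * c ^ i) * (1 + w * a * c ^ i) * (1 + w\<^sup>2 * a * c ^ i)"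
      using *[of "a * c ^ i"]
      by (simp add: power_mult_distrib mult.assoc mult.commute[of 3] flip: power_mult)
  qed
  moreover have "(\<lambda>n. qpoch_fin a c n * qpoch_fin (w * a) c n * qpoch_fin (w\<^sup>2 * a) c n)
      \<longlonglongrightarrow> qpoch a c * qpoch (w * a) c * qpoch (w\<^sup>2 * a) c"
    using assms by (intro tendsto_mult_fps qpoch_LIMSEQ)
  ultimately show ?thesis
    using qpoch_eqI[of "c ^ 3" "a ^ 3"] assms(1) by (simp add: fps_power_zeroth)
qed

lemma qpoch_split:
  assumes "c $ 0 = 0" "m > 0"
  shows "qpoch a c = (\<Prod>j<m. qpoch (a * c ^ j) (c ^ m))"
proof -
  \<comment> \<open>Truncation after \<open>n * m\<close> factors leaves exactly \<open>n\<close>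
    factors for each residue of the index modulo \<open>m\<close>.\<close>
  have fin: "qpoch_fin a c (n * m) = (\<Prod>j<m. qpoch_fin (a * c ^ j) (c ^ m) n)" for n
  proof (induction n)
    case (Suc n)
    have "qpoch_fin a c (Suc n * m) = qpoch_fin a c (n * m) * (\<Prod>j<m. 1 + a * c ^ (n * m + j))"
      unfolding qpoch_fin_def lessThan_atLeast0
      using prod.atLeastLessThan_concat[of 0 "n * m" "Suc n * m" "\<lambda>i. 1 + a * c ^ i"]
        prod.shift_bounds_nat_ivl[of "\<lambda>i. 1 + a * c ^ i" 0 "n * m" m]
      by (simp add: add.commute)
    also have "(\<Prod>j<m. 1 + a * c ^ (n * m + j)) = (\<Prod>j<m. 1 + (a * c ^ j) * (c ^ m) ^ n)"
      by (intro prod.cong refl) (simp add: power_add power_mult [symmetric] mult_ac)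
    finally show ?case
      by (simp add: Suc qpoch_fin_Suc prod.distrib)
  qed (simp add: qpoch_fin_def)
  have "(\<lambda>n. qpoch_fin a c (n * m)) \<longlonglongrightarrow> qpoch a c"
    using filterlim_compose[OF qpoch_LIMSEQ[OF assms(1)] mult_nat_right_at_top[OF assms(2)]] .
  moreover have "(\<lambda>n. qpoch_fin a c (n * m)) \<longlonglongrightarrow> (\<Prod>j<m. qpoch (a * c ^ j) (c ^ m))"
    unfolding fin using assms by (intro tendsto_prod_fps qpoch_LIMSEQ) (simp add: fps_power_zeroth)
  ultimately show ?thesis by (rule LIMSEQ_unique)
qed

lemma qpoch_rec:
  assumes "c $ 0 = 0"
  shows "qpoch a c = (1 + a) * qpoch (a * c) c"
proof -
  have "qpoch_fin a c (Suc n) = (1 + a) * qpoch_fin (a * c) c n" for n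
    unfolding qpoch_fin_def prod.lessThan_Suc_shift by (simp add: mult_ac)
  moreover have "(\<lambda>n. qpoch_fin a c (Suc n)) \<longlonglongrightarrow> qpoch a c"
    using qpoch_LIMSEQ[OF assms] by (rule LIMSEQ_Suc)
  moreover have "(\<lambda>n. (1 + a) * qpoch_fin (a * c) c n) \<longlonglongrightarrow> (1 + a) * qpoch (a * c) c"
    using assms by (intro tendsto_mult_fps qpoch_LIMSEQ tendsto_const)
  ultimately show ?thesis using LIMSEQ_unique by auto
qed

subsection \<open>The Jacobi triple product\<close>

text \<open>Gaussian binomial coefficients in base \<open>c\<close>; Pascal's rule avoids any
  division.\<close>

fun qbinomial :: "'a::comm_semiring_1 \<Rightarrow> nat \<Rightarrow> nat \<Rightarrow> 'a" where
  "qbinomial c n 0 = 1"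
| "qbinomial c 0 (Suc k) = 0"
| "qbinomial c (Suc n) (Suc k) = qbinomial c n k + c ^ Suc k * qbinomial c n (Suc k)"

lemma qbinomial_eq_0: "n < k \<Longrightarrow> qbinomial c n k = 0"
  by (induction c n k rule: qbinomial.induct) auto

text \<open>Since \<open>qpoch_fin (- c) c n\<close> is (c; c)_n, this is the usual quotient formula
  with denominators cleared, an induction along Pascal's rule.\<close>

lemma qbinomial_fact:
  assumes "k \<le> n"
  shows "qbinomial c n k * (qpoch_fin (- c) c k * qpoch_fin (- c) c (n - k)) = qpoch_fin (- c) c n"
  using assms
proof (induction c n k rule: qbinomial.induct)
  case (3 c n k)
  let ?p = "qpoch_fin (- c) c"
  show ?case
  proof (cases "k = n")
    case True
    then have "qbinomial c n n * ?p n = ?p n"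
      using 3(1) by (simp add: qpoch_fin_def [of _ _ 0])
    then have "qbinomial c n n * ?p (Suc n) = ?p (Suc n)"
      by (simp add: qpoch_fin_Suc mult.assoc [symmetric])
    then show ?thesis using True by (simp add: qbinomial_eq_0 qpoch_fin_def [of _ _ 0])
  next
    case False
    with 3 obtain d where d: "n = Suc (k + d)" by (metis Suc_le_mono le_neq_implies_less less_imp_Suc_add)
    have 1: "qbinomial c n k * (?p k * ?p (Suc d)) = ?p n"
      and 2: "qbinomial c n (Suc k) * (?p (Suc k) * ?p d) = ?p n"
      using 3 d by auto
    have "qbinomial c (Suc n) (Suc k) * (?p (Suc k) * ?p (Suc d))
        = qbinomial c n k * (?p k * ?p (Suc d)) * (1 - c ^ Suc k)
          + c ^ Suc k * (qbinomial c n (Suc k) * (?p (Suc k) * ?p d)) * (1 - c ^ Suc d)"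
      by (simp add: qpoch_fin_Suc algebra_simps)
    also have "\<dots> = ?p n * (1 - c ^ Suc n)"
      unfolding 1 2 using d by (simp add: algebra_simps power_add)
    finally show ?thesis using d by (simp add: qpoch_fin_Suc)
  qed
qed (auto simp: qpoch_fin_def)

lemma qpoch_fin_nonzero: "c $ 0 = 0 \<Longrightarrow> qpoch_fin (- c) c n \<noteq> 0"
proof
  assume "c $ 0 = 0" "qpoch_fin (- c) c n = 0"
  moreover have "c $ 0 = 0 \<Longrightarrow> qpoch_fin (- c) c n $ 0 = 1"
    by (induction n) (simp_all add: qpoch_fin_def fps_power_zeroth)
  ultimately show False by simp
qed

text \<open>Comparing the quotient formulas for \<open>k\<close> and \<open>k + 1\<close> converts
  the defining Pascal rule into its mirror image. The finite triple product needs both: one to add a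
  factor with \<open>b\<close>, the other to add one with \<open>a\<close>.\<close>

lemma qbinomial_Suc_Suc':
  fixes c :: "'a::field fps"
  assumes "c $ 0 = 0" "k \<le> n"
  shows "qbinomial c (Suc n) (Suc k) = c ^ (n - k) * qbinomial c n k + qbinomial c n (Suc k)"
proof (cases "k = n")
  case False
  with assms obtain d where d: "n = Suc (k + d)" by (metis le_neq_implies_less less_imp_Suc_add)
  let ?p = "qpoch_fin (- c) c"
  have "qbinomial c n k * (?p k * ?p (Suc d)) = qbinomial c n (Suc k) * (?p (Suc k) * ?p d)"
    using qbinomial_fact[of k n c] qbinomial_fact[of "Suc k" n c] d by simp
  then have "(qbinomial c n k * (1 - c ^ Suc d)) * (?p k * ?p d)
      = (qbinomial c n (Suc k) * (1 - c ^ Suc k)) * (?p k * ?p d)"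
    by (simp add: qpoch_fin_Suc mult_ac)
  then have "qbinomial c n k * (1 - c ^ Suc d) = qbinomial c n (Suc k) * (1 - c ^ Suc k)"
    using qpoch_fin_nonzero[OF assms(1)] by simp
  then show ?thesis using d by (simp add: algebra_simps)
qed (simp add: qbinomial_eq_0)

definition tri :: "int \<Rightarrow> nat" where
  "tri k = nat (k * (k + 1) div 2)"

text \<open>The terms of Ramanujan's theta function f(a, b). The exponents k(k+1)/2 and k(k-1)/2 are
  natural numbers for every integer \<open>k\<close>, so no inverses of \<open>a\<close> or
  \<open>b\<close> occur.\<close>

definition theta_term :: "'a::comm_ring_1 \<Rightarrow> 'a \<Rightarrow> int \<Rightarrow> 'a" where
  "theta_term a b k = a ^ tri k * b ^ tri (- k)"

lemma two_tri: "2 * int (tri k) = k * k + k"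
proof -
  have "0 \<le> k * (k + 1)" by (cases "k \<ge> 0") (auto simp: zero_le_mult_iff)
  then have "0 \<le> k * (k + 1) div 2" by simp
  then have "2 * int (tri k) = 2 * (k * (k + 1) div 2)" by (simp only: tri_def int_nat_eq if_True)
  also have "\<dots> = k * (k + 1)" by simp
  finally show ?thesis by (simp add: algebra_simps)
qed

lemma theta_term_0 [simp]: "theta_term a b 0 = 1"
  by (simp add: theta_term_def tri_def)

lemma theta_term_uminus: "theta_term a b (- k) = theta_term b a k"
  by (simp add: theta_term_def mult.commute)

text \<open>The ratio of consecutive terms is \<open>a * (a * b) ^ k\<close>; spreading it over the
  exponents \<open>n\<close> and \<open>n - k\<close> keeps both natural even for negative
  \<open>k\<close>.\<close>

lemma theta_term_up:
  assumes "k \<le> int n"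
  shows "a * (a * b) ^ n * theta_term a b k = (a * b) ^ nat (int n - k) * theta_term a b (k + 1)"
proof -
  obtain l where l: "k = int n - int l" using assms by (metis add.commute diff_add_cancel diff_diff_eq2 zle_iff_zadd)
  have 1: "Suc n + tri k = l + tri (k + 1)"
    using two_tri[of k] two_tri[of "k + 1"] unfolding l
    by (intro iffD1[OF of_nat_eq_iff[where 'a = int]]) (simp add: algebra_simps)
  have 2: "n + tri (- k) = l + tri (- (k + 1))"
    using two_tri[of "- k"] two_tri[of "- (k + 1)"] unfolding l
    by (intro iffD1[OF of_nat_eq_iff[where 'a = int]]) (simp add: algebra_simps)
  have "a * (a * b) ^ n * theta_term a b k = a ^ (Suc n + tri k) * b ^ (n + tri (- k))"
    by (simp add: theta_term_def power_add power_mult_distrib mult_ac)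
  also have "\<dots> = (a * b) ^ l * theta_term a b (k + 1)"
    unfolding 1 2 by (simp add: theta_term_def power_add power_mult_distrib mult_ac)
  finally show ?thesis by (simp add: l)
qed

lemma theta_term_down:
  assumes "- k \<le> int n"
  shows "b * (a * b) ^ n * theta_term a b k = (a * b) ^ nat (int n + k) * theta_term a b (k - 1)"
  using theta_term_up[OF assms, of b a] theta_term_uminus[of b a k] theta_term_uminus[of b a "k - 1"]
  by (simp add: mult.commute[of b a])

text \<open>The base case \<open>n = 0\<close> builds up the factors with \<open>b\<close>, the
  outer induction step adds those with \<open>a\<close>. Each new factor is absorbed by a Pascal
  rule together with a shift of the theta index.\<close>

lemma finite_jacobi_triple:
  fixes a b :: "'a::field fps"
  assumes "c = a * b" "c $ 0 = 0"
  shows "qpoch_fin b c m * qpoch_fin a c n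
      = (\<Sum>j\<le>m + n. qbinomial c (m + n) j * theta_term a b (int j - int m))"
proof (induction n)
  case 0
  show ?case
  proof (induction m)
    case (Suc m)
    let ?G = "qbinomial c" and ?t = "theta_term a b"
    have "(\<Sum>j\<le>Suc m. ?G (Suc m) j * ?t (int j - int (Suc m)))
        = ?t (- int (Suc m)) + (\<Sum>j\<le>m. ?G m j * ?t (int j - int m))
          + (\<Sum>j\<le>m. c ^ Suc j * ?G m (Suc j) * ?t (int (Suc j) - int (Suc m)))"
      by (subst sum.atMost_Suc_shift) (simp add: sum.distrib algebra_simps)
    \<comment> \<open>The isolated term becomes the \<open>j = 0\<close> summand of the last sum,
      which can then be written with an unshifted index.\<close>
    also have "?t (- int (Suc m)) = c ^ 0 * ?G m 0 * ?t (int 0 - int (Suc m))" by simp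
    also have "c ^ 0 * ?G m 0 * ?t (int 0 - int (Suc m)) + (\<Sum>j\<le>m. ?G m j * ?t (int j - int m))
        + (\<Sum>j\<le>m. c ^ Suc j * ?G m (Suc j) * ?t (int (Suc j) - int (Suc m)))
        = (\<Sum>j\<le>m. ?G m j * ?t (int j - int m)) + (\<Sum>j\<le>Suc m. c ^ j * ?G m j * ?t (int j - int (Suc m)))"
      unfolding sum.atMost_Suc_shift[of _ m] by (simp only: add_ac)
    also have "(\<Sum>j\<le>Suc m. c ^ j * ?G m j * ?t (int j - int (Suc m)))
        = (\<Sum>j\<le>m. c ^ j * ?G m j * ?t (int j - int (Suc m)))"
      by (simp add: qbinomial_eq_0)
    also have "\<dots> = (\<Sum>j\<le>m. b * c ^ m * (?G m j * ?t (int j - int m)))"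
    proof (intro sum.cong refl)
      fix j
      have "b * c ^ m * ?t (int j - int m) = c ^ j * ?t (int j - int (Suc m))"
        using theta_term_down[of "int j - int m" m b a] assms(1) by (simp add: diff_diff_eq add.commute)
      then show "c ^ j * ?G m j * ?t (int j - int (Suc m)) = b * c ^ m * (?G m j * ?t (int j - int m))"
        by (simp only: mult_ac)
    qed
    also have "(\<Sum>j\<le>m. ?G m j * ?t (int j - int m)) + \<dots>
        = qpoch_fin b c (Suc m) * qpoch_fin a c 0"
      unfolding sum_distrib_left[symmetric]
      using Suc by (simp add: qpoch_fin_Suc qpoch_fin_def[of _ _ 0] algebra_simps del: sum_distrib_left)
    finally show ?case by simp
  qed (simp add: qpoch_fin_def)
next
  case (Suc n)
  let ?G = "qbinomial c" and ?t = "theta_term a b" and ?N = "m + n"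
  have "(\<Sum>j\<le>Suc ?N. ?G (Suc ?N) j * ?t (int j - int m))
      = ?t (- int m) + (\<Sum>j\<le>?N. ?G (Suc ?N) (Suc j) * ?t (int (Suc j) - int m))"
    by (subst sum.atMost_Suc_shift) (simp del: qbinomial.simps(3))
  also have "(\<Sum>j\<le>?N. ?G (Suc ?N) (Suc j) * ?t (int (Suc j) - int m))
      = (\<Sum>j\<le>?N. a * c ^ n * (?G ?N j * ?t (int j - int m)) + ?G ?N (Suc j) * ?t (int (Suc j) - int m))"
  proof (intro sum.cong refl)
    fix j assume "j \<in> {..?N}"
    then have le: "int j - int m \<le> int n" and 1: "nat (int n - (int j - int m)) = ?N - j"
      and 2: "int j - int m + 1 = int (Suc j) - int m" by auto
    have *: "a * c ^ n * ?t (int j - int m) = c ^ (?N - j) * ?t (int (Suc j) - int m)"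
      using theta_term_up[OF le, of a b] unfolding 1 2 assms(1) .
    have "?G (Suc ?N) (Suc j) = c ^ (?N - j) * ?G ?N j + ?G ?N (Suc j)"
      using qbinomial_Suc_Suc'[OF assms(2)] \<open>j \<in> {..?N}\<close> by blast
    then have "?G (Suc ?N) (Suc j) * ?t (int (Suc j) - int m)
        = ?G ?N j * (c ^ (?N - j) * ?t (int (Suc j) - int m)) + ?G ?N (Suc j) * ?t (int (Suc j) - int m)"
      by (simp only: distrib_right mult.left_commute mult.assoc mult.commute[of "c ^ _"])
    also have "?G ?N j * (c ^ (?N - j) * ?t (int (Suc j) - int m)) = a * c ^ n * (?G ?N j * ?t (int j - int m))"
      unfolding *[symmetric] by (simp only: mult_ac)
    finally show "?G (Suc ?N) (Suc j) * ?t (int (Suc j) - int m)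
        = a * c ^ n * (?G ?N j * ?t (int j - int m)) + ?G ?N (Suc j) * ?t (int (Suc j) - int m)" .
  qed
  also have "?t (- int m) + \<dots> = a * c ^ n * (\<Sum>j\<le>?N. ?G ?N j * ?t (int j - int m))
      + (\<Sum>j\<le>Suc ?N. ?G ?N j * ?t (int j - int m))"
    unfolding sum.atMost_Suc_shift[of _ ?N] by (simp add: sum.distrib sum_distrib_left)
  also have "(\<Sum>j\<le>Suc ?N. ?G ?N j * ?t (int j - int m)) = (\<Sum>j\<le>?N. ?G ?N j * ?t (int j - int m))"
    by (simp add: qbinomial_eq_0)
  also have "a * c ^ n * (\<Sum>j\<le>?N. ?G ?N j * ?t (int j - int m)) + \<dots>
      = qpoch_fin b c m * qpoch_fin a c (Suc n)"
    unfolding Suc[symmetric] by (simp add: qpoch_fin_Suc algebra_simps)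
  finally show ?case unfolding add_Suc_right ..
qed

text \<open>Each coefficient receives only finitely many nonzero contributions. Being unordered,
  this summation allows any index type and free rearrangement, as the double theta series
  require.\<close>

definition fps_has_sum :: "('i \<Rightarrow> 'a::comm_ring_1 fps) \<Rightarrow> 'a fps \<Rightarrow> bool" where
  "fps_has_sum f S \<longleftrightarrow>
     (\<forall>n. finite {i. f i $ n \<noteq> 0} \<and> S $ n = (\<Sum>i | f i $ n \<noteq> 0. f i $ n))"

lemma fps_has_sum_nth:
  assumes "fps_has_sum f S" "finite I" "{i. f i $ n \<noteq> 0} \<subseteq> I"
  shows "S $ n = (\<Sum>i\<in>I. f i $ n)"
proof -
  have "S $ n = (\<Sum>i | f i $ n \<noteq> 0. f i $ n)"
    using assms(1) unfolding fps_has_sum_def by blast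
  also have "\<dots> = (\<Sum>i\<in>I. f i $ n)"
    using assms(2,3) by (intro sum.mono_neutral_left) auto
  finally show ?thesis .
qed

lemma fps_has_sum_unique: "fps_has_sum f S \<Longrightarrow> fps_has_sum f T \<Longrightarrow> S = T"
  unfolding fps_has_sum_def by (auto intro: fps_ext)

lemma fps_has_sumI:
  assumes "\<And>n. finite (I n)" "\<And>n. {i. f i $ n \<noteq> 0} \<subseteq> I n"
    and "\<And>n. S $ n = (\<Sum>i\<in>I n. f i $ n)"
  shows "fps_has_sum f S"
  unfolding fps_has_sum_def
proof (intro allI conjI)
  fix n
  show "finite {i. f i $ n \<noteq> 0}" using assms(1,2) by (rule finite_subset[rotated])
  show "S $ n = (\<Sum>i | f i $ n \<noteq> 0. f i $ n)"
    unfolding assms(3) using assms(1,2) by (intro sum.mono_neutral_right) auto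
qed

lemma fps_has_sum_finite: "fps_has_sum f S \<Longrightarrow> finite {i. f i $ n \<noteq> 0}"
  by (simp add: fps_has_sum_def)

lemma fps_has_sum_reindex:
  assumes "bij h" "fps_has_sum f S"
  shows "fps_has_sum (f \<circ> h) S"
  unfolding fps_has_sum_def
proof (intro allI conjI)
  fix n
  have eq: "{i. (f \<circ> h) i $ n \<noteq> 0} = h -` {i. f i $ n \<noteq> 0}" by auto
  show "finite {i. (f \<circ> h) i $ n \<noteq> 0}"
    unfolding eq using assms by (intro finite_vimageI fps_has_sum_finite bij_is_inj)
  have "bij_betw h (h -` {i. f i $ n \<noteq> 0}) {i. f i $ n \<noteq> 0}"
    using assms(1) by (auto simp: bij_betw_def inj_on_def bij_def surj_image_vimage_eq)
  then show "S $ n = (\<Sum>i | (f \<circ> h) i $ n \<noteq> 0. (f \<circ> h) i $ n)"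
    unfolding eq using assms(2) sum.reindex_bij_betw[of h _ _ "\<lambda>i. f i $ n"]
    by (simp add: fps_has_sum_def)
qed

lemma fps_has_sum_case_sum:
  assumes "fps_has_sum f S" "fps_has_sum g T"
  shows "fps_has_sum (case_sum f g) (S + T)"
proof (rule fps_has_sumI)
  fix n
  let ?A = "{i. f i $ n \<noteq> 0}" and ?B = "{i. g i $ n \<noteq> 0}"
  show "finite (?A <+> ?B)"
    using assms by (simp add: fps_has_sum_finite)
  show "{i. case_sum f g i $ n \<noteq> 0} \<subseteq> ?A <+> ?B"
  proof
    fix x assume "x \<in> {i. case_sum f g i $ n \<noteq> 0}"
    then show "x \<in> ?A <+> ?B" by (cases x) (auto intro: InlI InrI)
  qed
  show "(S + T) $ n = (\<Sum>i\<in>?A <+> ?B. case_sum f g i $ n)"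
    using assms by (simp add: sum.Plus fps_has_sum_def)
qed

lemma fps_has_sum_mult:
  assumes f: "fps_has_sum f S" and g: "fps_has_sum g T"
  shows "fps_has_sum (\<lambda>(i, j). f i * g j) (S * T)"
proof (rule fps_has_sumI)
  fix n
  \<comment> \<open>Only members with a nonzero coefficient in degree at most \<open>n\<close> can
    contribute to coefficient \<open>n\<close> of a product.\<close>
  let ?A = "\<Union>k\<le>n. {i. f i $ k \<noteq> 0}" and ?B = "\<Union>k\<le>n. {i. g i $ k \<noteq> 0}"
  show fin: "finite (?A \<times> ?B)"
    using f g by (simp add: fps_has_sum_finite)
  then have fA: "finite ?A" and fB: "finite ?B" using f g by (simp_all add: fps_has_sum_finite)
  show "{ij. (case ij of (i, j) \<Rightarrow> f i * g j) $ n \<noteq> 0} \<subseteq> ?A \<times> ?B"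
  proof (clarsimp simp: fps_mult_nth simp del: mult_eq_0_iff)
    fix i j assume "(\<Sum>k = 0..n. f i $ k * g j $ (n - k)) \<noteq> 0"
    then obtain k where "k \<in> {0..n}" "f i $ k * g j $ (n - k) \<noteq> 0"
      by (rule sum.not_neutral_contains_not_neutral)
    then show "(\<exists>k\<in>{..n}. f i $ k \<noteq> 0) \<and> (\<exists>k\<in>{..n}. g j $ k \<noteq> 0)"
      by (metis atLeastAtMost_iff atMost_iff diff_le_self mult_zero_left mult_zero_right)
  qed
  have "(S * T) $ n = (\<Sum>k=0..n. (\<Sum>i\<in>?A. f i $ k) * (\<Sum>j\<in>?B. g j $ (n - k)))"
    unfolding fps_mult_nth
  proof (intro sum.cong refl arg_cong2[of _ _ _ _ "(*)"] fps_has_sum_nth[OF f fA] fps_has_sum_nth[OF g fB])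
    fix k assume "k \<in> {0..n}"
    then have "k \<le> n" "n - k \<le> n" by auto
    then show "{i. f i $ k \<noteq> 0} \<subseteq> ?A" "{i. g i $ (n - k) \<noteq> 0} \<subseteq> ?B" by blast+
  qed
  also have "\<dots> = (\<Sum>k=0..n. \<Sum>(i, j)\<in>?A \<times> ?B. f i $ k * g j $ (n - k))"
    by (simp add: sum_product sum.cartesian_product)
  also have "\<dots> = (\<Sum>(i, j)\<in>?A \<times> ?B. (f i * g j) $ n)"
    by (subst sum.swap) (simp add: fps_mult_nth case_prod_unfold)
  finally show "(S * T) $ n = (\<Sum>ij\<in>?A \<times> ?B. (case ij of (i, j) \<Rightarrow> f i * g j) $ n)"
    by (simp add: case_prod_unfold)
qed

lemma fps_has_sum_cmult:
  assumes "fps_has_sum f S"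
  shows "fps_has_sum (\<lambda>i. c * f i) (c * S)"
proof -
  \<comment> \<open>A constant is the sum of a family with a single index.\<close>
  have "fps_has_sum (\<lambda>_::unit. c) c" by (rule fps_has_sumI[where I = "\<lambda>_. {()}"]) auto
  from fps_has_sum_mult[OF this assms] have *: "fps_has_sum (\<lambda>(i::unit, j). c * f j) (c * S)" .
  have "bij (Pair ())" by (rule bijI) (auto intro: injI)
  from fps_has_sum_reindex[OF this *] show ?thesis by (simp add: comp_def)
qed

text \<open>For \<open>k > 0\<close> the term is \<open>(a * b) ^ tri (- k) * a ^ k\<close> with
  \<open>tri (- k) \<ge> k - 1\<close>; negative \<open>k\<close> follow by symmetry. The bound
  comes from \<open>a * b\<close>, so one parameter may be a unit, as happens with the cube root of
  unity later.\<close>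

lemma X_power_dvd_theta_term:
  fixes a b :: "'a::field fps"
  assumes "(a * b) $ 0 = 0" "n < nat \<bar>k\<bar>"
  shows "fps_X ^ n dvd theta_term a b k"
proof -
  have *: "fps_X ^ n dvd theta_term a b k" if "(a * b) $ 0 = 0" "int n < k" for a b :: "'a fps" and k
  proof -
    define l where "l = nat (k - 1)"
    have k: "k = int l + 1" "n \<le> l" using that(2) by (auto simp: l_def)
    have 1: "tri k = tri (- k) + Suc l"
      using two_tri[of k] two_tri[of "- k"] k(1)
      by (intro iffD1[OF of_nat_eq_iff[where 'a = int]]) (simp add: algebra_simps)
    have "0 \<le> int l * (int l - 1)" by (cases l) auto
    then have "2 * int l \<le> 2 * int (tri (- k))"
      unfolding two_tri k(1) by (simp add: algebra_simps)
    then have 2: "l \<le> tri (- k)" by simp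
    have "theta_term a b k = (a * b) ^ tri (- k) * a ^ Suc l"
      unfolding theta_term_def 1 by (simp add: power_add power_mult_distrib mult_ac)
    then show ?thesis
      using X_power_dvd_power[OF that(1), of n "tri (- k)"] 2 k(2)
      by (metis dvd_mult2 order_trans)
  qed
  show ?thesis
  proof (cases "k \<ge> 0")
    case True
    then show ?thesis using *[OF assms(1), of k] assms(2) by simp
  next
    case False
    then show ?thesis using *[of b a "- k"] assms by (simp add: mult.commute theta_term_uminus)
  qed
qed

lemma sum_symmetric_interval:
  fixes f :: "int \<Rightarrow> 'a::comm_monoid_add"
  shows "(\<Sum>j\<le>n + n. f (int j - int n)) = (\<Sum>k=- int n..int n. f k)"
  by (rule sum.reindex_bij_witness[of _ "\<lambda>k. nat (k + int n)" "\<lambda>j. int j - int n"]) auto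

text \<open>For large \<open>k\<close> and \<open>m - k\<close> all three products in the quotient
  formula are close to (c; c)_\<infinity>. The congruence is obtained times the unit
  \<open>?D\<close>, which is then cancelled.\<close>

lemma qbinomial_cong:
  fixes c :: "'a::field fps"
  assumes c: "c $ 0 = 0" and k: "n \<le> k" "n \<le> m - k"
  shows "fps_X ^ n dvd qpoch (- c) c * qbinomial c m k - 1"
proof (cases "k \<le> m")
  case True
  let ?p = "qpoch_fin (- c) c" and ?D = "qpoch (- c) c"
  have "?D * ?D * qbinomial c m k - ?D
      = - qbinomial c m k * ((?p k - ?D) * ?p (m - k) + ?D * (?p (m - k) - ?D)) + (?p m - ?D)"
    using qbinomial_fact[OF True, of c] by (simp add: algebra_simps)
  moreover have "fps_X ^ n dvd ?p k - ?D" "fps_X ^ n dvd ?p (m - k) - ?D" "fps_X ^ n dvd ?p m - ?D"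
    using k True by (auto intro!: qpoch_cong c)
  ultimately have "fps_X ^ n dvd ?D * ?D * qbinomial c m k - ?D"
    by (simp only: dvd_add dvd_mult dvd_mult2)
  also have "?D * ?D * qbinomial c m k - ?D = (?D * qbinomial c m k - 1) * ?D"
    by (simp add: algebra_simps)
  finally show ?thesis
    using c by (simp add: dvd_mult_unit_iff)
next
  case False
  then have "n = 0" using k by simp
  then show ?thesis by simp
qed

theorem jacobi_triple_product:
  fixes a b :: "'a::field fps"
  assumes ab: "c = a * b" and c: "c $ 0 = 0"
  shows "fps_has_sum (theta_term a b) (qpoch a c * qpoch b c * qpoch (- c) c)"
proof (rule fps_has_sumI)
  fix N
  let ?t = "theta_term a b" and ?D = "qpoch (- c) c" and ?I = "{- int (Suc N)..int (Suc N)}"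
  have dvd: "fps_X ^ Suc N dvd ?t k" if "k \<notin> ?I" for k
    using X_power_dvd_theta_term[of a b "Suc N" k] that ab c by auto
  show "finite ?I" by simp
  have nth_0: "?t k $ N = 0" if "k \<notin> ?I" for k
    using dvd[OF that] unfolding X_power_dvd_iff by blast
  then show "{k. ?t k $ N \<noteq> 0} \<subseteq> ?I" by blast
  \<comment> \<open>With this choice \<open>k + n\<close> and \<open>n - k\<close> are both at least
    \<open>Suc N\<close> for every \<open>k\<close> in \<open>?I\<close>, as
    \<open>qbinomial_cong\<close> requires.\<close>
  define n where "n = 2 * Suc N"
  have "Suc N \<le> n" by (simp add: n_def)
  then have "fps_X ^ Suc N dvd
      (qpoch_fin a c n - qpoch a c) * (qpoch_fin b c n * ?D)
      + (qpoch a c * ?D) * (qpoch_fin b c n - qpoch b c)"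
    by (intro dvd_add dvd_mult dvd_mult2 qpoch_cong c)
  also have "\<dots> = qpoch_fin a c n * qpoch_fin b c n * ?D - qpoch a c * qpoch b c * ?D"
    by (simp add: algebra_simps)
  finally have 1: "fps_X ^ Suc N dvd
      qpoch_fin a c n * qpoch_fin b c n * ?D - qpoch a c * qpoch b c * ?D" .
  have "qpoch_fin a c n * qpoch_fin b c n
      = (\<Sum>k=-int n..int n. qbinomial c (n + n) (nat (k + int n)) * ?t k)"
    using finite_jacobi_triple[OF ab c, of n n]
      sum_symmetric_interval[of "\<lambda>k. qbinomial c (n + n) (nat (k + int n)) * ?t k" n]
    by (simp add: mult.commute)
  then have "qpoch_fin a c n * qpoch_fin b c n * ?D - (\<Sum>k=-int n..int n. ?t k)
      = (\<Sum>k=-int n..int n. (?D * qbinomial c (n + n) (nat (k + int n)) - 1) * ?t k)"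
    by (simp add: sum_distrib_left sum_subtractf algebra_simps)
  moreover have "fps_X ^ Suc N dvd (?D * qbinomial c (n + n) (nat (k + int n)) - 1) * ?t k" for k
  proof (cases "k \<in> ?I")
    case True
    then have "Suc N \<le> nat (k + int n)" "Suc N \<le> n + n - nat (k + int n)" by (auto simp: n_def)
    then show ?thesis by (intro dvd_mult2 qbinomial_cong[OF c])
  next
    case False
    then show ?thesis by (intro dvd_mult dvd)
  qed
  ultimately have 2: "fps_X ^ Suc N dvd
      qpoch_fin a c n * qpoch_fin b c n * ?D - (\<Sum>k=-int n..int n. ?t k)"
    by (simp add: dvd_sum del: power_Suc)
  have "(qpoch a c * qpoch b c * ?D) $ N = (qpoch_fin a c n * qpoch_fin b c n * ?D) $ N"
    using 1 by (simp add: X_power_dvd_iff del: power_Suc)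
  also have "\<dots> = (\<Sum>k=-int n..int n. ?t k) $ N"
    using 2 by (simp add: X_power_dvd_iff del: power_Suc)
  also have "\<dots> = (\<Sum>k\<in>?I. ?t k $ N)"
    unfolding fps_sum_nth using nth_0
    by (intro sum.mono_neutral_right) (auto simp: n_def)
  finally show "(qpoch a c * qpoch b c * ?D) $ N = (\<Sum>k\<in>?I. ?t k $ N)" .
qed

subsection \<open>An identity between squares of theta series\<close>

text \<open>The first copy covers the pairs \<open>(l, k)\<close> with \<open>l + k\<close> even,
  the second those with \<open>l + k\<close> odd. The inverse \<open>g\<close> takes half sums and
  half differences, after raising \<open>k\<close> by 1 in the odd case.\<close>

lemma bij_rotate_lattice:
  "bij (case_sum (\<lambda>(m, n). (m - n, m + n)) (\<lambda>(m, n). (m - n, m + n - 1 :: int)))"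
  (is "bij ?h")
proof -
  define g :: "int \<times> int \<Rightarrow> (int \<times> int) + (int \<times> int)" where
    "g = (\<lambda>(l, k). if even (l + k) then Inl ((k + l) div 2, (k - l) div 2)
                   else Inr ((k + 1 + l) div 2, (k + 1 - l) div 2))"
  have "g (?h x) = x" for x
    by (cases x) (auto simp: g_def)
  moreover have "?h (g y) = y" for y
  proof -
    obtain l k where y: "y = (l, k)" by force
    show ?thesis
    proof (cases "even (l + k)")
      case True
      then have "even (k + l)" "even (k - l)" by auto
      then obtain m n where "k + l = 2 * m" "k - l = 2 * n" by (elim evenE)
      then show ?thesis using True by (simp add: g_def y)
    next
      case False
      then have "even (k + 1 + l)" "even (k + 1 - l)" by auto
      then obtain m n where "k + 1 + l = 2 * m" "k + 1 - l = 2 * n" by (elim evenE)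
      then show ?thesis using False by (simp add: g_def y)
    qed
  qed
  ultimately show ?thesis by (intro o_bij[of g]) (auto simp: fun_eq_iff)
qed

lemma theta_term_monomial:
  fixes z v :: "'a::comm_ring_1"
  shows "theta_term (z ^ p * v ^ q) (z ^ r * v ^ s) k
      = z ^ (p * tri k + r * tri (- k)) * v ^ (q * tri k + s * tri (- k))"
  unfolding theta_term_def power_mult_distrib power_add power_mult by (simp only: mult_ac)

text \<open>The signs collect to the exponent \<open>tri k + tri (- k) = k * k\<close>.\<close>

lemma theta_term_minus:
  fixes a b :: "'a::comm_ring_1"
  shows "theta_term (- a) (- b) k = (if even k then 1 else - 1) * theta_term a b k"
proof -
  have "int (tri k + tri (- k)) = k * k"
    using two_tri[of k] two_tri[of "- k"] by simp
  then have "even (int (tri k + tri (- k))) \<longleftrightarrow> even k"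
    by (simp only: even_mult_iff) blast
  then have "even (tri k + tri (- k)) \<longleftrightarrow> even k"
    by (simp only: even_of_nat)
  moreover have "theta_term (- a) (- b) k = (- 1) ^ (tri k + tri (- k)) * theta_term a b k"
    unfolding theta_term_def power_minus[of a] power_minus[of b] power_add by (simp only: mult_ac)
  ultimately show ?thesis
    by (simp only: minus_one_power_iff)
qed

text \<open>Here \<open>v = P/z\<close> in the notation above. In the double series for the two squares substitute
  \<open>(k, l) = (m + n, m - n)\<close> and \<open>(k, l) = (m + n - 1, m - n)\<close>: they contribute the pairs \<open>(k, l)\<close> of
  equal and of opposite parity to the double series of the product on the right.\<close>

lemma theta_square_add_square:
  fixes z v :: "'a::field fps"
  assumes A: "fps_has_sum (theta_term (- (z ^ 3 * v ^ 2)) (- (z ^ 1 * v ^ 2))) A"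
    and B: "fps_has_sum (theta_term (- (z ^ 1 * v ^ 0)) (- (z ^ 3 * v ^ 4))) B"
    and F: "fps_has_sum (theta_term (- (z ^ 1 * v ^ 1)) (- (z ^ 1 * v ^ 1))) F"
    and J: "fps_has_sum (theta_term (z ^ 2 * v ^ 1) (z ^ 0 * v ^ 1)) J"
  shows "A * A + v * (B * B) = F * J"
proof -
  let ?a = "theta_term (- (z ^ 3 * v ^ 2)) (- (z ^ 1 * v ^ 2))"
  let ?b = "theta_term (- (z ^ 1 * v ^ 0)) (- (z ^ 3 * v ^ 4))"
  let ?f = "theta_term (- (z ^ 1 * v ^ 1)) (- (z ^ 1 * v ^ 1))"
  let ?j = "theta_term (z ^ 2 * v ^ 1) (z ^ 0 * v ^ 1)"
  let ?h = "case_sum (\<lambda>(m, n). (m - n, m + n)) (\<lambda>(m, n). (m - n, m + n - 1 :: int))"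
  have mono: "(s * (z ^ p * v ^ q)) * (t * (z ^ p' * v ^ q')) = (s * t) * (z ^ (p + p') * v ^ (q + q'))"
    for s t p q p' q' by (simp add: power_add mult_ac)
  have mono': "(s * (z ^ p * v ^ q)) * (z ^ p' * v ^ q') = s * (z ^ (p + p') * v ^ (q + q'))"
    for s p q p' q' by (simp add: power_add mult_ac)
  have mono'': "v * (s * (z ^ p * v ^ q)) = s * (z ^ p * v ^ (1 + q))"
    for s p q by (simp add: mult_ac)
  \<comment> \<open>Exponents of \<open>z\<close>, exponents of \<open>v\<close> and signs are
    compared separately; \<open>two_tri\<close> turns the first two into polynomial identities in
    \<open>m\<close> and \<open>n\<close>.\<close>
  have AA: "?a m * ?a n = ?f (m - n) * ?j (m + n)" for m n
  proof -
    have 1: "(3 * tri m + 1 * tri (- m)) + (3 * tri n + 1 * tri (- n))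
        = (1 * tri (m - n) + 1 * tri (- (m - n))) + (2 * tri (m + n) + 0 * tri (- (m + n)))"
      using two_tri[of m] two_tri[of n] two_tri[of "m - n"] two_tri[of "m + n"] two_tri[of "- m"]
        two_tri[of "- n"] two_tri[of "- (m - n)"] two_tri[of "- (m + n)"]
      by (intro iffD1[OF of_nat_eq_iff[where 'a = int]]) (simp add: algebra_simps)
    have 2: "(2 * tri m + 2 * tri (- m)) + (2 * tri n + 2 * tri (- n))
        = (1 * tri (m - n) + 1 * tri (- (m - n))) + (1 * tri (m + n) + 1 * tri (- (m + n)))"
      using two_tri[of m] two_tri[of n] two_tri[of "m - n"] two_tri[of "m + n"] two_tri[of "- m"]
        two_tri[of "- n"] two_tri[of "- (m - n)"] two_tri[of "- (m + n)"]
      by (intro iffD1[OF of_nat_eq_iff[where 'a = int]]) (simp add: algebra_simps)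
    have 3: "(if even m then 1 else - 1) * (if even n then 1 else - 1)
        = (if even (m - n) then 1 else - 1 :: 'a fps)" by simp
    show ?thesis
      unfolding theta_term_minus theta_term_monomial mono mono' 1 2 3 ..
  qed
  have BB: "v * (?b m * ?b n) = ?f (m - n) * ?j (m + n - 1)" for m n
  proof -
    have 1: "(1 * tri m + 3 * tri (- m)) + (1 * tri n + 3 * tri (- n))
        = (1 * tri (m - n) + 1 * tri (- (m - n))) + (2 * tri (m + n - 1) + 0 * tri (- (m + n - 1)))"
      using two_tri[of m] two_tri[of n] two_tri[of "m - n"] two_tri[of "m + n - 1"] two_tri[of "- m"]
        two_tri[of "- n"] two_tri[of "- (m - n)"] two_tri[of "- (m + n - 1)"]
      by (intro iffD1[OF of_nat_eq_iff[where 'a = int]]) (simp add: algebra_simps)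
    have 2: "1 + ((0 * tri m + 4 * tri (- m)) + (0 * tri n + 4 * tri (- n)))
        = (1 * tri (m - n) + 1 * tri (- (m - n))) + (1 * tri (m + n - 1) + 1 * tri (- (m + n - 1)))"
      using two_tri[of m] two_tri[of n] two_tri[of "m - n"] two_tri[of "m + n - 1"] two_tri[of "- m"]
        two_tri[of "- n"] two_tri[of "- (m - n)"] two_tri[of "- (m + n - 1)"]
      by (intro iffD1[OF of_nat_eq_iff[where 'a = int]]) (simp add: algebra_simps)
    have 3: "(if even m then 1 else - 1) * (if even n then 1 else - 1)
        = (if even (m - n) then 1 else - 1 :: 'a fps)" by simp
    show ?thesis
      unfolding theta_term_minus theta_term_monomial mono mono' mono'' 1 2 3 ..
  qed
  have 1: "fps_has_sum ((\<lambda>(l, k). ?f l * ?j k) \<circ> ?h) (F * J)"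
    by (intro fps_has_sum_reindex bij_rotate_lattice fps_has_sum_mult F J)
  have 2: "(\<lambda>(l, k). ?f l * ?j k) \<circ> ?h
      = case_sum (\<lambda>(m, n). ?a m * ?a n) (\<lambda>mn. v * (case mn of (m, n) \<Rightarrow> ?b m * ?b n))"
      proof
    fix x
    show "((\<lambda>(l, k). ?f l * ?j k) \<circ> ?h) x
        = case_sum (\<lambda>(m, n). ?a m * ?a n) (\<lambda>mn. v * (case mn of (m, n) \<Rightarrow> ?b m * ?b n)) x"
    proof (cases x)
      case (Inl p)
      then show ?thesis by (cases p) (simp only: comp_def sum.case prod.case AA)
    next
      case (Inr p)
      then show ?thesis by (cases p) (simp only: comp_def sum.case prod.case BB)
    qed
  qed
  have 3: "fps_has_sum (case_sum (\<lambda>(m, n). ?a m * ?a n)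
      (\<lambda>mn. v * (case mn of (m, n) \<Rightarrow> ?b m * ?b n))) (A * A + v * (B * B))"
    by (intro fps_has_sum_case_sum fps_has_sum_cmult fps_has_sum_mult A B)
  show ?thesis using fps_has_sum_unique[OF 3 1[unfolded 2]] .
qed

subsection \<open>Product formulas\<close>

text \<open>\<open>qprod j m\<close> is (q^j; q^m)_\<infinity>, and \<open>qprod_plus j m\<close> is
  (-q^j; q^m)_\<infinity>. The field is left arbitrary because one identity needs a cube root of
  unity.\<close>

definition qprod :: "nat \<Rightarrow> nat \<Rightarrow> 'a::field fps" where
  "qprod j m = qpoch (- (fps_X ^ j)) (fps_X ^ m)"

definition qprod_plus :: "nat \<Rightarrow> nat \<Rightarrow> 'a::field fps" where
  "qprod_plus j m = qpoch (fps_X ^ j) (fps_X ^ m)"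

abbreviation euler_prod :: "nat \<Rightarrow> 'a::field fps" where
  "euler_prod k \<equiv> qprod k k"

lemma qprod_nth_0: "j > 0 \<Longrightarrow> m > 0 \<Longrightarrow> qprod j m $ 0 = 1"
  by (simp add: qprod_def fps_X_power_nth)

lemma qprod_nonzero: "j > 0 \<Longrightarrow> m > 0 \<Longrightarrow> qprod j m \<noteq> 0"
  by (metis qprod_nth_0 fps_zero_nth zero_neq_one)

lemma qprod_plus_mult_qprod:
  "m > 0 \<Longrightarrow> qprod_plus j m * qprod j m = qprod (2 * j) (2 * m)"
  unfolding qprod_def qprod_plus_def
  by (subst qpoch_mult_minus) (simp_all add: fps_X_power_nth power_mult [symmetric] mult.commute)

lemma qprod_split:
  assumes "m > 0" "r > 0"
  shows "qprod j m = (\<Prod>i<r. qprod (j + m * i) (m * r))"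
  unfolding qprod_def
  by (subst qpoch_split[of _ r])
     (use assms in \<open>simp_all add: fps_X_power_nth power_add power_mult\<close>)

lemma jacobi_triple_product':
  fixes a b :: "'a::field fps"
  assumes "a * b = fps_X ^ m" "m > 0"
  shows "fps_has_sum (theta_term a b) (qpoch a (fps_X ^ m) * qpoch b (fps_X ^ m) * euler_prod m)"
  unfolding qprod_def using assms by (intro jacobi_triple_product) (simp_all add: fps_X_power_nth)

lemma prod_lessThan_numeral:
  fixes f :: "nat \<Rightarrow> 'a::comm_monoid_mult"
  shows "(\<Prod>i<2. f i) = f 0 * f 1" "(\<Prod>i<3. f i) = f 0 * f 1 * f 2"
    "(\<Prod>i<6. f i) = f 0 * f 1 * f 2 * f 3 * f 4 * f 5"
proof -
  have "{..<2::nat} = {0, 1}" "{..<3::nat} = {0, 1, 2}" "{..<6::nat} = {0, 1, 2, 3, 4, 5}" by auto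
  then show "(\<Prod>i<2. f i) = f 0 * f 1" "(\<Prod>i<3. f i) = f 0 * f 1 * f 2"
    "(\<Prod>i<6. f i) = f 0 * f 1 * f 2 * f 3 * f 4 * f 5"
    by (simp_all add: mult.assoc)
qed

text \<open>Once sorted by residues, relations between the \<open>euler_prod\<close> become monomial
  identities within reach of \<open>algebra\<close>.\<close>

lemma euler_prod_mod_6:
  "(euler_prod 1 :: 'a::field fps) = qprod 1 6 * qprod 2 6 * qprod 3 6 * qprod 4 6 * qprod 5 6 * euler_prod 6"
  "(euler_prod 2 :: 'a::field fps) = qprod 2 6 * qprod 4 6 * euler_prod 6"
  "(euler_prod 3 :: 'a::field fps) = qprod 3 6 * euler_prod 6"
proof -
  show "(euler_prod 1 :: 'a fps) = qprod 1 6 * qprod 2 6 * qprod 3 6 * qprod 4 6 * qprod 5 6 * euler_prod 6"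
    by (subst qprod_split[of 1 6]) (simp_all add: prod_lessThan_numeral flip: numeral_2_eq_2 del: One_nat_def)
  show "(euler_prod 2 :: 'a fps) = qprod 2 6 * qprod 4 6 * euler_prod 6"
    by (subst qprod_split[of 2 3]) (simp_all add: prod_lessThan_numeral flip: numeral_2_eq_2 del: One_nat_def)
  show "(euler_prod 3 :: 'a fps) = qprod 3 6 * euler_prod 6"
    by (subst qprod_split[of 3 2]) (simp_all add: prod_lessThan_numeral flip: numeral_2_eq_2 del: One_nat_def)
qed

lemma euler_prod_mod_12:
  "(euler_prod 2 :: 'a::field fps) = qprod 2 12 * qprod 4 12 * qprod 6 12 * qprod 8 12 * qprod 10 12 * euler_prod 12"
  "(euler_prod 4 :: 'a::field fps) = qprod 4 12 * qprod 8 12 * euler_prod 12"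
  "(euler_prod 6 :: 'a::field fps) = qprod 6 12 * euler_prod 12"
proof -
  show "(euler_prod 2 :: 'a fps) = qprod 2 12 * qprod 4 12 * qprod 6 12 * qprod 8 12 * qprod 10 12 * euler_prod 12"
    by (subst qprod_split[of 2 6]) (simp_all add: prod_lessThan_numeral flip: numeral_2_eq_2 del: One_nat_def)
  show "(euler_prod 4 :: 'a fps) = qprod 4 12 * qprod 8 12 * euler_prod 12"
    by (subst qprod_split[of 4 3]) (simp_all add: prod_lessThan_numeral flip: numeral_2_eq_2 del: One_nat_def)
  show "(euler_prod 6 :: 'a fps) = qprod 6 12 * euler_prod 12"
    by (subst qprod_split[of 6 2]) (simp_all add: prod_lessThan_numeral flip: numeral_2_eq_2 del: One_nat_def)
qed

text \<open>The instances \<open>P = e * q^3\<close>, \<open>z = q^2\<close>, hence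
  \<open>v = e * q\<close>, for both signs \<open>e\<close> at once.\<close>

lemma theta_square_dissection:
  fixes e :: "'a::field fps"
  assumes e: "e = 1 \<or> e = - 1"
  defines "R \<equiv> \<lambda>j. qpoch (e * fps_X ^ j) (fps_X ^ 6)"
  shows "euler_prod 4 * euler_prod 4
        + e * fps_X * (qprod 2 12 * qprod 10 12 * euler_prod 12 * (qprod 2 12 * qprod 10 12 * euler_prod 12))
      = qpoch (- (e * fps_X ^ 3)) (fps_X ^ 6) * qpoch (- (e * fps_X ^ 3)) (fps_X ^ 6) * euler_prod 6
        * (R 5 * R 1 * euler_prod 6)"
proof -
  have ee: "e * e = 1" using e by auto
  have e2: "e\<^sup>2 = 1" and e4: "e ^ 4 = 1" using ee by (simp_all add: power2_eq_square power4_eq_xxxx)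
  let ?z = "fps_X\<^sup>2 :: 'a fps" and ?v = "e * fps_X :: 'a fps"
  \<comment> \<open>\<open>v\<close> enters the parameters of \<open>A\<close> and \<open>B\<close>
    in even powers only, so the sign \<open>e\<close> drops out there and survives in those of
    \<open>F\<close> and \<open>J\<close>.\<close>
  have A: "fps_has_sum (theta_term (- (?z ^ 3 * ?v ^ 2)) (- (?z ^ 1 * ?v ^ 2))) (euler_prod 4)"
  proof -
    have "?z ^ 3 * ?v ^ 2 = fps_X ^ 8" "?z ^ 1 * ?v ^ 2 = fps_X ^ 4"
      by (simp_all add: power_mult_distrib e2 flip: power_mult power_add)
    moreover have "fps_has_sum (theta_term (- (fps_X ^ 8)) (- (fps_X ^ 4)))
       (qprod 8 12 * qprod 4 12 * euler_prod 12 :: 'a fps)"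
      unfolding qprod_def[of 8] qprod_def[of 4]
      by (rule jacobi_triple_product') (simp_all flip: power_add)
    ultimately show ?thesis by (simp add: euler_prod_mod_12 mult_ac)
  qed
  have B: "fps_has_sum (theta_term (- (?z ^ 1 * ?v ^ 0)) (- (?z ^ 3 * ?v ^ 4)))
      (qprod 2 12 * qprod 10 12 * euler_prod 12)"
  proof -
    have "?z ^ 1 * ?v ^ 0 = fps_X ^ 2" "?z ^ 3 * ?v ^ 4 = fps_X ^ 10"
      by (simp_all add: power_mult_distrib e4 flip: power_mult power_add)
    moreover have "fps_has_sum (theta_term (- (fps_X ^ 2)) (- (fps_X ^ 10)))
       (qprod 2 12 * qprod 10 12 * euler_prod 12 :: 'a fps)"
      unfolding qprod_def[of 2] qprod_def[of 10]
      by (rule jacobi_triple_product') (simp_all flip: power_add)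
    ultimately show ?thesis by simp
  qed
  have F: "fps_has_sum (theta_term (- (?z ^ 1 * ?v ^ 1)) (- (?z ^ 1 * ?v ^ 1)))
      (qpoch (- (e * fps_X ^ 3)) (fps_X ^ 6) * qpoch (- (e * fps_X ^ 3)) (fps_X ^ 6) * euler_prod 6)"
  proof -
    have "?z ^ 1 * ?v ^ 1 = e * fps_X ^ 3"
      by (simp add: power3_eq_cube power2_eq_square mult_ac)
    moreover have "e * fps_X ^ 3 * (e * fps_X ^ 3) = (e * e) * fps_X ^ 6"
      by (simp add: eval_nat_numeral mult_ac)
    then have "e * fps_X ^ 3 * (e * fps_X ^ 3) = fps_X ^ 6" by (simp add: ee)
    ultimately show ?thesis by (simp only:) (intro jacobi_triple_product'; simp)
  qed
  have J: "fps_has_sum (theta_term (?z ^ 2 * ?v ^ 1) (?z ^ 0 * ?v ^ 1)) (R 5 * R 1 * euler_prod 6)"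
  proof -
    have "?z ^ 2 * ?v ^ 1 = e * fps_X ^ 5" "?z ^ 0 * ?v ^ 1 = e * fps_X ^ 1"
      by (simp_all add: eval_nat_numeral mult_ac)
    moreover have "e * fps_X ^ 5 * (e * fps_X ^ 1) = (e * e) * fps_X ^ 6"
      by (simp add: eval_nat_numeral mult_ac)
    then have "e * fps_X ^ 5 * (e * fps_X ^ 1) = fps_X ^ 6" by (simp add: ee)
    ultimately show ?thesis unfolding R_def by (simp only:) (intro jacobi_triple_product'; simp)
  qed
  show ?thesis by (rule theta_square_add_square [OF A B F J])
qed

text \<open>The square of \<open>B / euler_prod 4\<close> is \<open>s / q\<close>, so the case
  \<open>e = 1\<close> divided by \<open>euler_prod 4 ^ 2\<close> has \<open>1 + s\<close> on the
  left. This is its product formula with denominators cleared.\<close>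

lemma dissection_plus:
  "euler_prod 1 * (euler_prod 4 ^ 4 * euler_prod 6 ^ 2 + fps_X * euler_prod 2 ^ 2 * euler_prod 12 ^ 4)
     = euler_prod 2 ^ 2 * euler_prod 3 ^ 3 * euler_prod 12 * (euler_prod 4 :: 'a::field fps)"
proof -
  let ?e = "euler_prod :: nat \<Rightarrow> 'a fps"
  define B where "B = (qprod 2 12 * qprod 10 12 * euler_prod 12 :: 'a fps)"
  define H5 H1 g3 where "H5 = (qprod_plus 5 6 :: 'a fps)" and "H1 = (qprod_plus 1 6 :: 'a fps)"
    and "g3 = (qprod 3 6 :: 'a fps)"
  have W: "?e 4 * ?e 4 + fps_X * (B * B) = g3 * g3 * ?e 6 * (H5 * H1 * ?e 6)"
    using theta_square_dissection[of "1 :: 'a fps"]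
    by (simp add: B_def H5_def H1_def g3_def qprod_def[of 3] qprod_plus_def)
  have B: "B * ?e 4 * ?e 6 = ?e 2 * ?e 12 ^ 2"
    unfolding B_def euler_prod_mod_12 by algebra
  have H: "?e 1 * H5 * H1 * ?e 12 = B * ?e 2 * g3"
  proof -
    have "H5 * qprod 5 6 = qprod 10 12" "H1 * qprod 1 6 = qprod 2 12"
      using qprod_plus_mult_qprod[of 6 5] qprod_plus_mult_qprod[of 6 1] by (simp_all add: H5_def H1_def)
    note * = this [symmetric]
    show ?thesis unfolding B_def g3_def euler_prod_mod_6 * by algebra
  qed
  have g3: "?e 3 = g3 * ?e 6" unfolding g3_def euler_prod_mod_6 ..
  \<comment> \<open>The auxiliary factor \<open>?e 12\<close> makes \<open>H\<close> applicable and
    is cancelled at the end.\<close>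
  have "?e 12 * (?e 1 * (?e 4 ^ 4 * ?e 6 ^ 2 + fps_X * ?e 2 ^ 2 * ?e 12 ^ 4))
      = ?e 12 * (?e 1 * (?e 4 ^ 4 * ?e 6 ^ 2 + fps_X * (B * ?e 4 * ?e 6) ^ 2))"
    unfolding B by algebra
  also have "\<dots> = ?e 12 * ?e 1 * ?e 4 ^ 2 * ?e 6 ^ 2 * (?e 4 * ?e 4 + fps_X * (B * B))"
    by algebra
  also have "\<dots> = (?e 1 * H5 * H1 * ?e 12) * ?e 4 ^ 2 * ?e 6 ^ 4 * g3 ^ 2"
    unfolding W by algebra
  also have "\<dots> = (B * ?e 4 * ?e 6) * ?e 2 * (g3 * ?e 6) ^ 3 * ?e 4"
    unfolding H by algebra
  also have "\<dots> = ?e 12 * (?e 2 ^ 2 * ?e 3 ^ 3 * ?e 12 * ?e 4)"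
    unfolding B g3 by algebra
  finally show ?thesis using qprod_nonzero[of 12 12, where 'a = 'a] by simp
qed

text \<open>The case \<open>e = - 1\<close> gives the product formula for \<open>1 - s\<close> in
  the same way.\<close>

lemma dissection_minus:
  "euler_prod 2 * euler_prod 3 ^ 3 * euler_prod 12 ^ 2
     * (euler_prod 4 ^ 4 * euler_prod 6 ^ 2 - fps_X * euler_prod 2 ^ 2 * euler_prod 12 ^ 4)
   = euler_prod 1 * euler_prod 6 ^ 9 * (euler_prod 4 :: 'a::field fps) ^ 2"
proof -
  let ?e = "euler_prod :: nat \<Rightarrow> 'a fps"
  define B where "B = (qprod 2 12 * qprod 10 12 * euler_prod 12 :: 'a fps)"
  define H3 g1 g3 g5 where "H3 = (qprod_plus 3 6 :: 'a fps)" and "g1 = (qprod 1 6 :: 'a fps)"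
    and "g3 = (qprod 3 6 :: 'a fps)" and "g5 = (qprod 5 6 :: 'a fps)"
  have W: "?e 4 * ?e 4 - fps_X * (B * B) = H3 * H3 * ?e 6 * (g5 * g1 * ?e 6)"
    using theta_square_dissection[of "- 1 :: 'a fps"]
    unfolding B_def H3_def g1_def g5_def qprod_def[of 1] qprod_def[of 5] qprod_plus_def by simp
  have B: "B * ?e 4 * ?e 6 = ?e 2 * ?e 12 ^ 2"
    unfolding B_def euler_prod_mod_12 by algebra
  have H: "H3 * g3 * ?e 12 = ?e 6"
    using qprod_plus_mult_qprod[of 6 3, where 'a = 'a] by (simp add: H3_def g3_def euler_prod_mod_12)
  have e1: "?e 1 = g1 * g3 * g5 * ?e 2"
    unfolding g1_def g3_def g5_def euler_prod_mod_6 by algebra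
  have e3: "?e 3 = g3 * ?e 6" unfolding g3_def euler_prod_mod_6 ..
  have "?e 2 * ?e 3 ^ 3 * ?e 12 ^ 2 * (?e 4 ^ 4 * ?e 6 ^ 2 - fps_X * ?e 2 ^ 2 * ?e 12 ^ 4)
      = ?e 2 * ?e 3 ^ 3 * ?e 12 ^ 2 * (?e 4 ^ 4 * ?e 6 ^ 2 - fps_X * (B * ?e 4 * ?e 6) ^ 2)"
    unfolding B by algebra
  also have "\<dots> = ?e 2 * ?e 3 ^ 3 * ?e 12 ^ 2 * ?e 4 ^ 2 * ?e 6 ^ 2 * (?e 4 * ?e 4 - fps_X * (B * B))"
    by algebra
  also have "\<dots> = (g1 * g3 * g5 * ?e 2) * (H3 * g3 * ?e 12) ^ 2 * ?e 4 ^ 2 * ?e 6 ^ 7"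
    unfolding W e3 by algebra
  also have "\<dots> = ?e 1 * ?e 6 ^ 9 * ?e 4 ^ 2"
    unfolding H e1[symmetric] by algebra
  finally show ?thesis .
qed

text \<open>The product formula for \<open>1 + 3s\<close>, from \<open>z = w\<close>,
  \<open>P = - q\<close>. Products twisted by \<open>w\<close> and \<open>w\<^sup>2\<close> combine
  with the untwisted one into a product in cubes, and the coefficient 3 arises as
  \<open>- (w\<^sup>2 * (1 - w)\<^sup>2)\<close>.\<close>

lemma dissection_cubic:
  fixes w :: "'a::field fps"
  assumes w: "1 + w + w\<^sup>2 = 0"
  shows "euler_prod 1 ^ 3 * euler_prod 4 ^ 2 * euler_prod 6
       * (euler_prod 4 ^ 4 * euler_prod 6 ^ 2 + 3 * fps_X * euler_prod 2 ^ 2 * euler_prod 12 ^ 4)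
     = euler_prod 2 ^ 9 * euler_prod 12 ^ 2 * (euler_prod 3 :: 'a fps)"
proof -
  let ?e = "euler_prod :: nat \<Rightarrow> 'a fps"
  have w3: "w ^ 3 = 1"
  proof -
    have "w ^ 3 - 1 = (w - 1) * (1 + w + w\<^sup>2)" by (simp add: algebra_simps eval_nat_numeral)
    then show ?thesis using w by simp
  qed
  \<comment> \<open>This is \<open>P / z\<close>, with \<open>w\<^sup>2\<close> as the inverse of
    \<open>w\<close>.\<close>
  define v where "v = - (w\<^sup>2 * fps_X)"
  define Q1 Q2 where "Q1 = qpoch (- (w * fps_X ^ 2)) (fps_X ^ 4)"
    and "Q2 = qpoch (- (w\<^sup>2 * fps_X ^ 2)) (fps_X ^ 4)"
  define R1 R2 where "R1 = qpoch (- (w * fps_X ^ 4)) (fps_X ^ 4)"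
    and "R2 = qpoch (- (w\<^sup>2 * fps_X ^ 4)) (fps_X ^ 4)"
  define S1 S2 where "S1 = qpoch (- (w * fps_X)) (fps_X\<^sup>2)"
    and "S2 = qpoch (- (w\<^sup>2 * fps_X)) (fps_X\<^sup>2)"
  define H where "H = (qprod_plus 1 2 :: 'a fps)"
  have A: "fps_has_sum (theta_term (- (w ^ 3 * v ^ 2)) (- (w ^ 1 * v ^ 2))) (Q1 * Q2 * ?e 4)"
  proof -
    have "w ^ 3 * v ^ 2 = w ^ 3 * (w ^ 3 * (w * fps_X ^ 2))" "w ^ 1 * v ^ 2 = w ^ 3 * (w\<^sup>2 * fps_X ^ 2)"
      unfolding v_def by (simp_all add: eval_nat_numeral mult_ac)
    moreover have "- (w * fps_X ^ 2) * - (w\<^sup>2 * fps_X ^ 2) = w ^ 3 * (fps_X ^ 4 :: 'a fps)" by algebra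
    ultimately show ?thesis unfolding w3 mult_1 Q1_def Q2_def
      by (simp only:) (intro jacobi_triple_product'; simp)
  qed
  have B: "fps_has_sum (theta_term (- (w ^ 1 * v ^ 0)) (- (w ^ 3 * v ^ 4))) ((1 - w) * ?e 12)"
  proof -
    \<comment> \<open>Splitting off the factor of index 0 leaves \<open>R1\<close>, which together
      with \<open>R2\<close> and \<open>?e 4\<close> forms a full cube-root triple.\<close>
    have "qpoch (- w) (fps_X ^ 4) = (1 - w) * R1"
      unfolding R1_def by (subst qpoch_rec) simp_all
    moreover have "?e 4 * R1 * R2 = ?e 12"
      using qpoch_mult_cube_roots[of "fps_X ^ 4" w "- (fps_X ^ 4)"] w
      by (simp add: R1_def R2_def qprod_def fps_X_power_nth flip: power_mult)
    ultimately have *: "qpoch (- w) (fps_X ^ 4) * R2 * ?e 4 = (1 - w) * ?e 12"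
      by (simp add: mult_ac)
    have "w ^ 1 * v ^ 0 = w" "w ^ 3 * v ^ 4 = w ^ 3 * (w ^ 3 * (w ^ 3 * (w\<^sup>2 * fps_X ^ 4)))"
      unfolding v_def by (simp_all add: eval_nat_numeral mult_ac)
    moreover have "- w * - (w\<^sup>2 * fps_X ^ 4) = w ^ 3 * (fps_X ^ 4 :: 'a fps)" by algebra
    ultimately show ?thesis unfolding w3 mult_1 R2_def *[symmetric]
      by (simp only:) (intro jacobi_triple_product'; simp)
  qed
  have F: "fps_has_sum (theta_term (- (w ^ 1 * v ^ 1)) (- (w ^ 1 * v ^ 1))) (H * H * ?e 2)"
  proof -
    have "- (w ^ 1 * v ^ 1) = w ^ 3 * fps_X ^ 1" unfolding v_def by (simp add: eval_nat_numeral mult_ac)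
    moreover have "fps_has_sum (theta_term (fps_X ^ 1) (fps_X ^ 1 :: 'a fps)) (H * H * ?e 2)"
      unfolding H_def qprod_plus_def by (intro jacobi_triple_product'; simp add: power2_eq_square)
    ultimately show ?thesis unfolding w3 by simp
  qed
  have J: "fps_has_sum (theta_term (w ^ 2 * v ^ 1) (w ^ 0 * v ^ 1)) (S1 * S2 * ?e 2)"
  proof -
    have "w ^ 2 * v ^ 1 = - (w ^ 3 * (w * fps_X))" "w ^ 0 * v ^ 1 = - (w\<^sup>2 * fps_X)"
      unfolding v_def by (simp_all add: eval_nat_numeral mult_ac)
    moreover have "- (w * fps_X) * - (w\<^sup>2 * fps_X) = w ^ 3 * (fps_X\<^sup>2 :: 'a fps)" by algebra
    ultimately show ?thesis unfolding w3 mult_1 S1_def S2_def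
      by (simp only:) (intro jacobi_triple_product'; simp)
  qed
  have Q: "qprod 2 4 * Q1 * Q2 = qprod 6 12"
    using qpoch_mult_cube_roots[of "fps_X ^ 4" w "- (fps_X ^ 2)"] w
    by (simp add: Q1_def Q2_def qprod_def fps_X_power_nth flip: power_mult)
  have S: "qprod 1 2 * S1 * S2 = qprod 3 6"
    using qpoch_mult_cube_roots[of "fps_X ^ 2" w "- fps_X"] w
    by (simp add: S1_def S2_def qprod_def fps_X_power_nth flip: power_mult)
  have e: "?e 1 = qprod 1 2 * ?e 2" "?e 2 = qprod 2 4 * ?e 4" "?e 3 = qprod 3 6 * ?e 6"
    "?e 6 = qprod 6 12 * ?e 12"
    by (subst qprod_split[of _ 2]; simp add: prod_lessThan_numeral flip: numeral_2_eq_2 del: One_nat_def)+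
  have H: "H * qprod 1 2 = qprod 2 4"
    using qprod_plus_mult_qprod[of 2 1, where 'a = 'a] by (simp add: H_def)
  have w': "- (w\<^sup>2 * (1 - w)\<^sup>2) = 3"
  proof -
    have "- (w\<^sup>2 * (1 - w)\<^sup>2) = 3 + (1 + w + w\<^sup>2) * (3 * w - 3 - w\<^sup>2)" by algebra
    then show ?thesis using w by simp
  qed
  have "(Q1 * Q2 * ?e 4) * (Q1 * Q2 * ?e 4) + v * ((1 - w) * ?e 12 * ((1 - w) * ?e 12))
      = H * H * ?e 2 * (S1 * S2 * ?e 2)"
    by (rule theta_square_add_square [OF A B F J])
  also have "v * ((1 - w) * ?e 12 * ((1 - w) * ?e 12)) = - (w\<^sup>2 * (1 - w)\<^sup>2) * fps_X * ?e 12 ^ 2"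
    unfolding v_def by algebra
  finally have W: "(Q1 * Q2 * ?e 4)\<^sup>2 + 3 * fps_X * ?e 12 ^ 2 = H * H * ?e 2 * (S1 * S2 * ?e 2)"
    unfolding w' by (simp only: power2_eq_square)
  have A': "Q1 * Q2 * ?e 4 * ?e 2 * ?e 12 = ?e 4 ^ 2 * ?e 6"
    unfolding e(2,4) Q[symmetric] by algebra
  have "?e 1 ^ 3 * ?e 4 ^ 2 * ?e 6 * (?e 4 ^ 4 * ?e 6 ^ 2 + 3 * fps_X * ?e 2 ^ 2 * ?e 12 ^ 4)
     = ?e 1 ^ 3 * ?e 4 ^ 2 * ?e 6 * ((?e 4 ^ 2 * ?e 6) ^ 2 + 3 * fps_X * ?e 2 ^ 2 * ?e 12 ^ 4)"
    by algebra
  also have "\<dots> = ?e 1 ^ 3 * ?e 4 ^ 2 * ?e 6 * ?e 2 ^ 2 * ?e 12 ^ 2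
      * ((Q1 * Q2 * ?e 4)\<^sup>2 + 3 * fps_X * ?e 12 ^ 2)"
    unfolding A'[symmetric] by algebra
  also have "\<dots> = (H * qprod 1 2)\<^sup>2 * (qprod 1 2 * S1 * S2) * ?e 4 ^ 2 * ?e 6 * ?e 2 ^ 7 * ?e 12 ^ 2"
    unfolding W e(1) by algebra
  also have "\<dots> = (qprod 2 4 * ?e 4)\<^sup>2 * (qprod 3 6 * ?e 6) * ?e 2 ^ 7 * ?e 12 ^ 2"
    unfolding H S by algebra
  also have "\<dots> = ?e 2 ^ 9 * ?e 12 ^ 2 * ?e 3"
    unfolding e(2)[symmetric] e(3)[symmetric] by algebra
  finally show ?thesis .
qed

subsection \<open>Polynomials and valuations\<close>

lemma poly_in_xi_eq:
  assumes "degree p \<le> n"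
  shows "poly_in_xi p = (\<Sum>m\<le>n. fps_const (of_int (coeff p m)) * xi_fps ^ m)"
  unfolding poly_in_xi_def using assms
  by (intro sum.mono_neutral_left) (auto simp: coeff_eq_0)

lemma poly_in_xi_add: "poly_in_xi (p + q) = poly_in_xi p + poly_in_xi q"
proof -
  define n where "n = max (degree p) (degree q)"
  have "degree p \<le> n" "degree q \<le> n" "degree (p + q) \<le> n"
    by (auto simp: n_def intro: degree_add_le_max)
  then show ?thesis
    by (simp add: poly_in_xi_eq[where n = n] sum.distrib distrib_right flip: fps_const_add)
qed

lemma poly_in_xi_smult: "poly_in_xi (smult c p) = fps_const (of_int c) * poly_in_xi p"
proof -
  have "degree (smult c p) \<le> degree p" by (rule degree_smult_le)
  then show ?thesis
    by (simp add: poly_in_xi_eq[where n = "degree p"] sum_distrib_left mult.assoc flip: fps_const_mult)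
qed

lemma poly_in_xi_diff: "poly_in_xi (p - q) = poly_in_xi p - poly_in_xi q"
  using poly_in_xi_add[of p "- q"] poly_in_xi_smult[of "- 1" q]
  by (simp flip: fps_const_neg)

lemma poly_in_xi_pCons: "poly_in_xi (pCons c p) = fps_const (of_int c) + xi_fps * poly_in_xi p"
proof -
  have deg: "degree (pCons c p) \<le> Suc (degree p)" by (rule degree_pCons_le)
  show ?thesis
    unfolding poly_in_xi_eq[OF deg] poly_in_xi_def[of p] sum.atMost_Suc_shift
    by (simp add: sum_distrib_left mult_ac)
qed

lemma poly_in_xi_0 [simp]: "poly_in_xi 0 = 0"
  by (simp add: poly_in_xi_def)

lemma poly_in_xi_monom_mult: "poly_in_xi (monom 1 k * p) = xi_fps ^ k * poly_in_xi p"
  by (induction k) (simp_all add: monom_Suc poly_in_xi_pCons mult.assoc flip: one_pCons)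

text \<open>Dividing out the powers of \<open>x - 1\<close>, a nonzero polynomial relation for \<open>xi_fps\<close> could be
  evaluated at the constant term 1 of \<open>xi_fps\<close>.\<close>

lemma inj_poly_in_xi:
  assumes "xi_fps $ 0 = 1" "xi_fps \<noteq> 1"
  shows "inj poly_in_xi"
proof (rule injI, rule ccontr)
  fix p q assume eq: "poly_in_xi p = poly_in_xi q" and "p \<noteq> q"
  then obtain r where r: "p - q = [:- 1, 1:] ^ order 1 (p - q) * r" "\<not> [:- 1, 1:] dvd r"
    using order_decomp[of "p - q" 1] by auto
  have pow: "poly_in_xi ([:- 1, 1:] ^ k * r) = (xi_fps - 1) ^ k * poly_in_xi r" for k
    by (induction k) (simp_all add: mult.assoc poly_in_xi_diff poly_in_xi_pCons poly_in_xi_smult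
        poly_in_xi_add algebra_simps)
  have "0 = poly_in_xi (p - q)" using eq by (simp add: poly_in_xi_diff)
  also have "\<dots> = (xi_fps - 1) ^ order 1 (p - q) * poly_in_xi r"
    using r(1) pow by metis
  finally have "poly_in_xi r $ 0 = 0" using assms(2) by simp
  moreover have "poly_in_xi r $ 0 = of_int (poly r 1)"
    using assms(1) by (induction r) (simp_all add: poly_in_xi_pCons)
  ultimately have "poly r 1 = 0" by simp
  then show False using r(2) by (simp add: poly_eq_0_iff_dvd)
qed

text \<open>\<open>zpoly n\<close> is \<open>xi_fps ^ ((n + 1) div 2) * a\<^sub>n\<close> as a polynomial in \<open>\<xi>\<close>, the exponent
  being the degree of \<open>a\<^sub>n\<close> in \<open>1/\<xi>\<close>.\<close>

fun zpoly :: "nat \<Rightarrow> int poly" where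
  "zpoly 0 = 1"
| "zpoly (Suc 0) = [:- 3, 4:]"
| "zpoly (Suc (Suc n)) = (if even n then smult 2 (zpoly (Suc n)) else pCons 0 (smult 2 (zpoly (Suc n)))) - zpoly n"

lemma zpoly_step:
  "zpoly (2 * Suc k) = smult 2 (zpoly (Suc (2 * k))) - zpoly (2 * k)"
  "zpoly (Suc (2 * Suc k)) = pCons 0 (smult 2 (zpoly (2 * Suc k))) - zpoly (Suc (2 * k))"
  by simp_all

text \<open>Exact values are kept where divisibility is too weak: the constant coefficients must be
  odd, and half the linear one at odd index is odd exactly for odd \<open>k\<close>.\<close>

lemma zpoly_low_coeffs:
  "coeff (zpoly (2 * k)) 0 = (- 1) ^ k * (6 * int k + 1) \<and>
   coeff (zpoly (Suc (2 * k))) 0 = (- 1) ^ k * (- 3) \<and>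
   coeff (zpoly (Suc (2 * k))) 1 = (- 1) ^ k * (2 * (3 * int k ^ 2 + 4 * int k + 2))"
proof (induction k)
  case (Suc k)
  then show ?case
    unfolding zpoly_step(2) coeff_diff unfolding zpoly_step(1)
    by (simp add: algebra_simps power2_eq_square)
qed simp

text \<open>Every step of the recurrence brings a factor 2, but only every other step shifts the
  degree, so each degree gains two powers of 2.\<close>

lemma zpoly_dvd_coeffs:
  "2 ^ (2 * M) dvd coeff (zpoly (2 * k)) M \<and> 2 ^ (2 * M - 1) dvd coeff (zpoly (Suc (2 * k))) M"
proof (induction k arbitrary: M)
  case 0
  have "2 ^ (2 * M) dvd coeff (1 :: int poly) M" by (cases M) auto
  moreover have "2 ^ (2 * M - 1) dvd coeff [:- 3, 4 :: int:] M"
  proof (cases M)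
    case (Suc m)
    then show ?thesis by (cases m) auto
  qed simp
  ultimately show ?case by simp
next
  case (Suc k)
  have even: "2 ^ (2 * M) dvd coeff (zpoly (2 * Suc k)) M" for M
  \<comment> \<open>Subtraction is truncated, so \<open>2 ^ (2 * M)\<close> is twice
    \<open>2 ^ (2 * M - 1)\<close> only for \<open>M > 0\<close>; for \<open>M = 0\<close> the claim
    is trivial.\<close>
  proof (cases M)
    case (Suc m)
    have "2 * 2 ^ (2 * M - 1) dvd 2 * coeff (zpoly (Suc (2 * k))) M"
      using Suc.IH by (intro mult_dvd_mono) auto
    moreover have "(2 :: int) ^ (2 * M) = 2 * 2 ^ (2 * M - 1)"
      unfolding power_Suc[symmetric] using Suc by simp
    ultimately have "2 ^ (2 * M) dvd 2 * coeff (zpoly (Suc (2 * k))) M" by (simp only:)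
    then show ?thesis
      unfolding zpoly_step(1) coeff_diff coeff_smult using Suc.IH by (intro dvd_diff) blast+
  qed simp
  moreover have "2 ^ (2 * M - 1) dvd coeff (zpoly (Suc (2 * Suc k))) M"
  proof (cases M)
    case (Suc m)
    have "2 * 2 ^ (2 * m) dvd 2 * coeff (zpoly (2 * Suc k)) m"
      using even by (intro mult_dvd_mono) auto
    then have "2 ^ (2 * M - 1) dvd coeff (pCons 0 (smult 2 (zpoly (2 * Suc k)))) M"
      using Suc by simp
    then show ?thesis
      unfolding zpoly_step(2) coeff_diff using Suc.IH by (intro dvd_diff) blast+
  qed simp
  ultimately show ?case by blast
qed

section \<open>Valuations of the coefficients of \<zeta>\<close>

lemma nu_geI: "2 ^ m dvd n \<Longrightarrow> enat m \<le> nu n"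
  by (auto simp: nu_def intro: multiplicity_geI)

lemma nu_eqI:
  assumes "odd n"
  shows "nu (2 ^ m * n) = enat m"
  using assms by (auto simp: nu_def multiplicity_times_unit_right intro!: multiplicity_eqI)

text \<open>Injectivity gives \<open>THE\<close> in \<open>Z\<close> a unique candidate; the
  monomial factor only shifts the coefficient index.\<close>

lemma nu_Z:
  assumes inj: "inj poly_in_xi" and "zeta i j = poly_in_xi (monom 1 m * p)"
  shows "\<exists>!p. zeta i j = poly_in_xi p" "Z i j (m + k) = coeff p k"
proof -
  show "\<exists>!p. zeta i j = poly_in_xi p"
    using assms by (metis injD)
  moreover from this have "(THE p. zeta i j = poly_in_xi p) = monom 1 m * p"
    using assms(2) by (rule the1_equality)
  ultimately show "Z i j (m + k) = coeff p k"
    by (simp add: Z_def coeff_monom_mult)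
qed

text \<open>The q-series enter only through the assumptions. For \<open>i = 0\<close> the exponent
  5i - 2 would be negative, so that case has its own polynomial; otherwise the exponent has the
  parity of \<open>i\<close>.\<close>

lemma valuations_of_Z:
  assumes inj: "inj poly_in_xi"
    and z0: "zeta 0 1 = poly_in_xi (monom 1 1 * [:5, - 4:])"
    and z: "\<And>i. i > 0 \<Longrightarrow> zeta i 1 = poly_in_xi (monom 1 (d i 1) * zpoly (5 * i - 2))"
  shows "(\<exists>!p. zeta i 1 = poly_in_xi p) \<and>
         nu (Z i 1 (d i 1)) = 0 \<and>
         (if i mod 4 = 1 then nu (Z i 1 (d i 1 + 1)) = 1
                         else nu (Z i 1 (d i 1 + 1)) \<ge> 2) \<and>
         (\<forall>M::nat. M \<ge> 2 \<longrightarrow> nu (Z i 1 (d i 1 + M)) \<ge> enat M + 1)"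
proof -
  define p where "p = (if i = 0 then [:5, - 4:] else zpoly (5 * i - 2))"
  have "zeta i 1 = poly_in_xi (monom 1 (d i 1) * p)"
    using z0 z by (auto simp: p_def d_def)
  note Z = nu_Z[OF inj this]
  have "odd (coeff p 0) \<and> (if i mod 4 = 1 then \<exists>n. odd n \<and> coeff p 1 = 2 * n else 4 dvd coeff p 1)
      \<and> (\<forall>M\<ge>2. 2 ^ Suc M dvd coeff p M)"
  proof -
    consider "i = 0" | "i > 0" "even i" | "odd i" by auto
    then show ?thesis
    proof cases
      case 1
      have "coeff [:5, - 4 :: int:] M = 0" if "M \<ge> 2" for M
        using that by (intro coeff_eq_0) auto
      then show ?thesis using 1 by (auto simp: p_def)
    next
      case 2
      then obtain I where I: "i = 2 * Suc I" by (metis evenE mult_0_right gr0_implies_Suc not_gr_zero)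
      have "5 * i - 2 = 2 * (5 * I + 4)" by (simp add: I)
      then have p: "p = zpoly (2 * (5 * I + 4))" using I by (simp only: p_def) simp
      have dvd: "2 ^ Suc M dvd coeff p M" if "M \<ge> 1" for M
      proof -
        have "Suc M \<le> 2 * M" using that by simp
        then have "(2 :: int) ^ Suc M dvd 2 ^ (2 * M)" by (rule le_imp_power_dvd)
        then show ?thesis using zpoly_dvd_coeffs[of M "5 * I + 4"] dvd_trans unfolding p by blast
      qed
      moreover have "4 dvd coeff p 1" using dvd[of 1] by simp
      moreover have "odd (coeff p 0)" unfolding p using zpoly_low_coeffs[of "5 * I + 4"] by simp
      moreover have "i mod 4 \<noteq> 1" using 2 by presburger
      ultimately show ?thesis by simp
    next
      case 3
      then obtain I where I: "i = 2 * I + 1" by (elim oddE)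
      define k where "k = 5 * I + 1"
      have "5 * i - 2 = Suc (2 * k)" by (simp add: I k_def)
      then have p: "p = zpoly (Suc (2 * k))" using I by (simp only: p_def) simp
      have "2 ^ Suc M dvd coeff p M" if "M \<ge> 2" for M
      proof -
        have "Suc M \<le> 2 * M - 1" using that by simp
        then have "(2 :: int) ^ Suc M dvd 2 ^ (2 * M - 1)" by (rule le_imp_power_dvd)
        then show ?thesis using zpoly_dvd_coeffs[of M k] dvd_trans unfolding p by blast
      qed
      moreover have "odd (coeff p 0)" unfolding p using zpoly_low_coeffs[of k] by simp
      \<comment> \<open>The factor \<open>n\<close> is odd exactly when \<open>k = 5 * I + 1\<close>
        is odd, that is, when \<open>I\<close> is even; this is where the residue of
        \<open>i\<close> modulo 4 enters.\<close>
      moreover define n where "n = (- 1) ^ k * (3 * int k ^ 2 + 4 * int k + 2)"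
      have "coeff p 1 = 2 * n" unfolding p n_def using zpoly_low_coeffs[of k] by simp
      moreover have "odd n \<longleftrightarrow> odd k" by (simp add: n_def)
      moreover have "odd k \<longleftrightarrow> i mod 4 = 1" unfolding k_def I by presburger
      ultimately show ?thesis by auto
    qed
  qed
  then have *: "odd (coeff p 0)" "i mod 4 = 1 \<Longrightarrow> \<exists>n. odd n \<and> coeff p 1 = 2 ^ 1 * n"
    "i mod 4 \<noteq> 1 \<Longrightarrow> 2 ^ 2 dvd coeff p 1" "\<And>M. M \<ge> 2 \<Longrightarrow> 2 ^ Suc M dvd coeff p M"
    by (auto split: if_splits)
  have "nu (Z i 1 (d i 1)) = 0"
    using nu_eqI[OF *(1), of 0] Z(2)[of 0] by (simp add: zero_enat_def)
  moreover have "nu (Z i 1 (d i 1 + 1)) = 1" if "i mod 4 = 1"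
    using *(2)[OF that] Z(2)[of 1] nu_eqI[of _ 1] by (auto simp: one_enat_def)
  moreover have "nu (Z i 1 (d i 1 + 1)) \<ge> 2" if "i mod 4 \<noteq> 1"
    using nu_geI[OF *(3)[OF that]] Z(2)[of 1] by (simp add: numeral_eq_enat)
  moreover have "nu (Z i 1 (d i 1 + M)) \<ge> enat M + 1" if "M \<ge> 2" for M
    using nu_geI[OF *(4)[OF that]] Z(2)[of M] by (simp add: one_enat_def)
  ultimately show ?thesis using Z(1) by simp
qed

subsection \<open>Passage to the given series\<close>

lemma dil_eq_compose: "dil k f = f oo fps_X ^ k"
  by (rule fps_ext) (simp add: dil_def fps_nth_compose_X_power)

lemma dil_hom:
  assumes "k > 0"
  shows "dil k (f + g) = dil k f + dil k g" "dil k (f - g) = dil k f - dil k g"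
    "dil k (f * g) = dil k f * dil k g" "dil k (f ^ n) = dil k f ^ n" "dil k 1 = 1"
  using assms unfolding dil_eq_compose
  by (simp_all add: fps_compose_add_distrib fps_compose_sub_distrib fps_compose_mult_distrib
      fps_compose_power fps_X_power_nth)

lemma dil_numeral: "k > 0 \<Longrightarrow> dil k (numeral m) = numeral m"
  unfolding dil_eq_compose by (simp add: numeral_fps_const)

lemma dil_X: "k > 0 \<Longrightarrow> dil k fps_X = fps_X ^ k"
  unfolding dil_eq_compose by (simp add: fps_X_power_nth)

lemma dil_uminus: "dil k (- f) = - dil k f"
  by (rule fps_ext) (simp add: dil_def)

lemma dil_nth_mult: "k > 0 \<Longrightarrow> dil k f $ (k * n) = f $ n"
  by (simp add: dil_def)

lemma inj_dil: "k > 0 \<Longrightarrow> dil k f = dil k g \<Longrightarrow> f = g"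
  by (metis dil_nth_mult fps_ext)

lemma dil_qpoch_fin:
  "k > 0 \<Longrightarrow> dil k (qpoch_fin a c n) = qpoch_fin (dil k a) (dil k c) n"
  by (induction n) (simp_all add: qpoch_fin_Suc qpoch_fin_def[of _ _ 0] dil_hom)

lemma dil_qpoch:
  assumes "k > 0" "c $ 0 = 0"
  shows "dil k (qpoch a c) = qpoch (dil k a) (dil k c)"
proof (rule fps_ext)
  fix n
  have "dil k (qpoch a c) $ n = dil k (qpoch_fin a c (Suc n)) $ n"
  proof -
    have "n div k < Suc n" by (simp add: le_imp_less_Suc)
    then show ?thesis
      using qpoch_cong[OF assms(2) order_refl, of "Suc n" a] by (simp add: X_power_dvd_iff dil_def del: power_Suc)
  qed
  then show "dil k (qpoch a c) $ n = qpoch (dil k a) (dil k c) $ n"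
    using assms(1) by (simp add: dil_qpoch_fin qpoch_def)
qed

lemma E_fps_eq: "E_fps = qpoch (- fps_X) fps_X"
proof (rule fps_ext)
  fix n
  have "(\<Prod>m\<in>{1..n}. 1 - fps_X ^ m) = qpoch_fin (- fps_X) (fps_X :: rat fps) n"
    unfolding qpoch_fin_def
    by (rule prod.reindex_bij_witness[of _ Suc "\<lambda>m. m - 1"]) (auto simp flip: power_Suc)
  \<comment> \<open>\<open>E_fps\<close> truncates after \<open>n\<close> factors,
    \<open>qpoch\<close> after \<open>n + 1\<close>; the surplus factor leaves coefficient
    \<open>n\<close> unchanged.\<close>
  moreover have "qpoch_fin (- fps_X) fps_X (Suc n) $ n
      = (qpoch_fin (- fps_X) (fps_X :: rat fps) n * (1 - fps_X ^ Suc n)) $ n"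
    by (simp add: qpoch_fin_Suc)
  then have "qpoch_fin (- fps_X) fps_X (Suc n) $ n = qpoch_fin (- fps_X) (fps_X :: rat fps) n $ n"
    by (simp add: right_diff_distrib fps_X_power_mult_right_nth del: power_Suc)
  ultimately show "E_fps $ n = qpoch (- fps_X) fps_X $ n"
    by (simp add: E_fps_def qpoch_def)
qed

lemma E_eq: "k > 0 \<Longrightarrow> E k = euler_prod k"
  unfolding E_def E_fps_eq qprod_def
  by (simp add: dil_qpoch dil_uminus dil_X)

text \<open>The rationals contain no primitive cube root of unity, so the cubic identity is proved
  over the complex numbers and pulled back along this injective ring homomorphism.\<close>

definition fps_complex_of_rat :: "rat fps \<Rightarrow> complex fps" where
  "fps_complex_of_rat f = Abs_fps (\<lambda>n. of_rat (f $ n))"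

lemma fps_complex_of_rat_hom:
  "fps_complex_of_rat (f + g) = fps_complex_of_rat f + fps_complex_of_rat g"
  "fps_complex_of_rat (f * g) = fps_complex_of_rat f * fps_complex_of_rat g"
  "fps_complex_of_rat (- f) = - fps_complex_of_rat f"
  "fps_complex_of_rat 1 = 1" "fps_complex_of_rat fps_X = fps_X"
  by (rule fps_ext; simp add: fps_complex_of_rat_def of_rat_add of_rat_mult of_rat_sum of_rat_minus
      fps_mult_nth fps_X_def)+

lemma fps_complex_of_rat_power: "fps_complex_of_rat (f ^ n) = fps_complex_of_rat f ^ n"
  by (induction n) (simp_all add: fps_complex_of_rat_hom)

lemma inj_fps_complex_of_rat: "fps_complex_of_rat f = fps_complex_of_rat g \<Longrightarrow> f = g"
  by (simp add: fps_eq_iff fps_complex_of_rat_def)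

lemma fps_complex_of_rat_qprod: "fps_complex_of_rat (qprod j m) = qprod j m"
proof -
  have fin: "fps_complex_of_rat (qpoch_fin a c n)
      = qpoch_fin (fps_complex_of_rat a) (fps_complex_of_rat c) n" for a c n
    by (induction n) (simp_all add: qpoch_fin_Suc qpoch_fin_def[of _ _ 0] fps_complex_of_rat_hom
        fps_complex_of_rat_power)
  have nth: "fps_complex_of_rat f $ n = of_rat (f $ n)" for f n
    by (simp add: fps_complex_of_rat_def)
  have "fps_complex_of_rat (qpoch a c) = qpoch (fps_complex_of_rat a) (fps_complex_of_rat c)" for a c
    by (rule fps_ext) (simp add: qpoch_def nth flip: fin)
  then show ?thesis
    by (simp add: qprod_def fps_complex_of_rat_hom fps_complex_of_rat_power)
qed

lemma dissection_cubic_rat: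
  "euler_prod 1 ^ 3 * euler_prod 4 ^ 2 * euler_prod 6
       * (euler_prod 4 ^ 4 * euler_prod 6 ^ 2 + 3 * fps_X * euler_prod 2 ^ 2 * euler_prod 12 ^ 4)
     = euler_prod 2 ^ 9 * euler_prod 12 ^ 2 * (euler_prod 3 :: rat fps)"
proof (rule inj_fps_complex_of_rat)
  define w where "w = Complex (- 1 / 2) (sqrt 3 / 2)"
  have "1 + w + w\<^sup>2 = 0"
    by (simp add: w_def complex_eq_iff power2_eq_square)
  then have w: "1 + fps_const w + (fps_const w)\<^sup>2 = 0"
    by (simp add: fps_const_power flip: fps_const_1_eq_1 fps_const_add)
  have "fps_complex_of_rat (1 + 1 + 1) = 1 + 1 + 1"
    by (simp only: fps_complex_of_rat_hom)
  then have three: "fps_complex_of_rat 3 = 3" by simp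
  show "fps_complex_of_rat (euler_prod 1 ^ 3 * euler_prod 4 ^ 2 * euler_prod 6
       * (euler_prod 4 ^ 4 * euler_prod 6 ^ 2 + 3 * fps_X * euler_prod 2 ^ 2 * euler_prod 12 ^ 4))
     = fps_complex_of_rat (euler_prod 2 ^ 9 * euler_prod 12 ^ 2 * euler_prod 3)"
    unfolding fps_complex_of_rat_hom fps_complex_of_rat_power fps_complex_of_rat_qprod three
    by (rule dissection_cubic[OF w])
qed

section \<open>The operator U on series in q^2 and on odd series\<close>

lemma U_dil: "U (dil 2 f) = f"
  by (rule fps_ext) (simp add: U_def dil_def)

lemma U_X_dil: "U (fps_X * dil 2 f) = 0"
proof (rule fps_ext)
  fix n show "U (fps_X * dil 2 f) $ n = 0 $ n"
    by (cases n) (auto simp: U_def dil_def)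
qed

lemma U_add: "U (f + g) = U f + U g"
  by (rule fps_ext) (simp add: U_def)

lemma fps_eq_divide: "(f :: 'a::field fps) $ 0 \<noteq> 0 \<Longrightarrow> g / f * f = g"
  by (simp add: fps_divide_unit inverse_mult_eq_1 mult.assoc)

lemma dil_euler_prod: "k > 0 \<Longrightarrow> m > 0 \<Longrightarrow> dil k (euler_prod m) = euler_prod (k * m)"
  by (simp add: qprod_def dil_qpoch dil_uminus dil_hom dil_X fps_X_power_nth flip: power_mult)

section \<open>The series \<xi>, \<gamma>, \<kappa> in terms of s\<close>

abbreviation e :: "nat \<Rightarrow> rat fps" where "e \<equiv> euler_prod"

lemma e_nth_0 [simp]: "k > 0 \<Longrightarrow> e k $ 0 = 1"
  by (simp add: qprod_nth_0)

lemma e_nonzero [simp]: "k > 0 \<Longrightarrow> e k \<noteq> 0"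
  by (simp add: qprod_nonzero)

text \<open>In the notation above, \<open>sigma = s\<close> and \<open>dil 2 chi = s\<^sup>2\<close>.\<close>

definition rho :: "rat fps" where
  "rho = e 1 ^ 2 * e 6 ^ 4 / (e 2 ^ 4 * e 3 ^ 2)"

definition sigma :: "rat fps" where
  "sigma = fps_X * dil 2 rho"

lemma rho_eq: "rho * (e 2 ^ 4 * e 3 ^ 2) = e 1 ^ 2 * e 6 ^ 4"
  unfolding rho_def by (rule fps_eq_divide) (simp add: fps_power_zeroth)

lemma sigma_eq: "e 4 ^ 4 * e 6 ^ 2 * sigma = fps_X * e 2 ^ 2 * e 12 ^ 4"
proof -
  have "dil 2 rho * (e 4 ^ 4 * e 6 ^ 2) = e 2 ^ 2 * e 12 ^ 4"
    using arg_cong[OF rho_eq, of "dil 2"] by (simp add: dil_hom dil_euler_prod)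
  then have "fps_X * (dil 2 rho * (e 4 ^ 4 * e 6 ^ 2)) = fps_X * (e 2 ^ 2 * e 12 ^ 4)" by simp
  then show ?thesis unfolding sigma_def by (simp only: mult_ac)
qed

lemma xi_eq: "xi_fps * (e 1 * e 3 ^ 5) = e 2 ^ 5 * e 6"
  unfolding xi_fps_def by (simp add: E_eq fps_eq_divide)

lemma gamma_eq: "gamma_fps * e 3 ^ 15 = e 1 ^ 5 * e 2 ^ 5 * e 6 ^ 5"
  unfolding gamma_fps_def by (simp add: E_eq fps_eq_divide)

lemma gamma_nth_0: "gamma_fps $ 0 = 1"
  using arg_cong[OF gamma_eq, of "\<lambda>f. f $ 0"] by (simp add: fps_power_zeroth)

lemma xi_nth_0: "xi_fps $ 0 = 1"
  using arg_cong[OF xi_eq, of "\<lambda>f. f $ 0"] by (simp add: fps_power_zeroth)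

lemma one_plus_sigma: "e 1 * e 4 ^ 3 * e 6 ^ 2 * (1 + sigma) = e 2 ^ 2 * e 3 ^ 3 * e 12"
proof -
  have "e 4 * (e 1 * e 4 ^ 3 * e 6 ^ 2 * (1 + sigma))
      = e 1 * (e 4 ^ 4 * e 6 ^ 2 + e 4 ^ 4 * e 6 ^ 2 * sigma)" by algebra
  also have "\<dots> = e 4 * (e 2 ^ 2 * e 3 ^ 3 * e 12)"
    unfolding sigma_eq dissection_plus by algebra
  finally show ?thesis by simp
qed

lemma one_minus_sigma: "e 2 * e 3 ^ 3 * e 12 ^ 2 * e 4 ^ 2 * (1 - sigma) = e 1 * e 6 ^ 7"
proof -
  have "(e 4 ^ 2 * e 6 ^ 2) * (e 2 * e 3 ^ 3 * e 12 ^ 2 * e 4 ^ 2 * (1 - sigma))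
      = e 2 * e 3 ^ 3 * e 12 ^ 2 * (e 4 ^ 4 * e 6 ^ 2 - e 4 ^ 4 * e 6 ^ 2 * sigma)" by algebra
  also have "\<dots> = (e 4 ^ 2 * e 6 ^ 2) * (e 1 * e 6 ^ 7)"
    unfolding sigma_eq dissection_minus by algebra
  finally show ?thesis by simp
qed

lemma one_plus_3_sigma: "e 1 ^ 3 * e 4 ^ 6 * e 6 ^ 3 * (1 + 3 * sigma) = e 2 ^ 9 * e 12 ^ 2 * e 3"
proof -
  have "e 1 ^ 3 * e 4 ^ 6 * e 6 ^ 3 * (1 + 3 * sigma)
      = e 1 ^ 3 * e 4 ^ 2 * e 6 * (e 4 ^ 4 * e 6 ^ 2 + 3 * (e 4 ^ 4 * e 6 ^ 2 * sigma))" by algebra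
  also have "\<dots> = e 1 ^ 3 * e 4 ^ 2 * e 6 * (e 4 ^ 4 * e 6 ^ 2 + 3 * fps_X * e 2 ^ 2 * e 12 ^ 4)"
    unfolding sigma_eq by algebra
  finally show ?thesis unfolding dissection_cubic_rat .
qed

lemma dil_xi_eq: "dil 2 xi_fps * (e 2 * e 6 ^ 5) = e 4 ^ 5 * e 12"
  using arg_cong[OF xi_eq, of "dil 2"] by (simp add: dil_hom dil_euler_prod)

lemma dil_gamma_eq: "dil 2 gamma_fps * e 6 ^ 15 = e 2 ^ 5 * e 4 ^ 5 * e 12 ^ 5"
  using arg_cong[OF gamma_eq, of "dil 2"] by (simp add: dil_hom dil_euler_prod)

text \<open>Multiplying by the product \<open>?D\<close> of all denominators lets the product
  formulas be substituted; \<open>?D\<close> is nonzero and cancels. The next two lemmas use the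
  same device.\<close>

lemma dil_xi_sigma: "dil 2 xi_fps * ((1 + sigma) * (1 - sigma)) = 1"
proof -
  let ?D = "(e 2 * e 6 ^ 5) * (e 1 * e 4 ^ 3 * e 6 ^ 2) * (e 2 * e 3 ^ 3 * e 12 ^ 2 * e 4 ^ 2)"
  have "?D * (dil 2 xi_fps * ((1 + sigma) * (1 - sigma)))
      = (dil 2 xi_fps * (e 2 * e 6 ^ 5)) * (e 1 * e 4 ^ 3 * e 6 ^ 2 * (1 + sigma))
        * (e 2 * e 3 ^ 3 * e 12 ^ 2 * e 4 ^ 2 * (1 - sigma))" by algebra
  also have "\<dots> = ?D * 1"
    unfolding dil_xi_eq one_plus_sigma one_minus_sigma by algebra
  finally show ?thesis
    by (subst (asm) mult_cancel_left) simp
qed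

lemma xi_sigma: "xi_fps * (1 + sigma) ^ 2 = 1 + 3 * sigma"
proof -
  let ?D = "(e 1 * e 3 ^ 5) * (e 1 * e 4 ^ 3 * e 6 ^ 2) ^ 2"
  have "?D * (xi_fps * (1 + sigma) ^ 2)
      = (xi_fps * (e 1 * e 3 ^ 5)) * (e 1 * e 4 ^ 3 * e 6 ^ 2 * (1 + sigma)) ^ 2" by algebra
  also have "\<dots> = (e 2 ^ 9 * e 12 ^ 2 * e 3) * (e 6 * e 3 ^ 5)"
    unfolding xi_eq one_plus_sigma by algebra
  also have "\<dots> = ?D * (1 + 3 * sigma)"
    unfolding one_plus_3_sigma[symmetric] by algebra
  finally show ?thesis
    by (subst (asm) mult_cancel_left) simp
qed

lemma kappa_eq: "kappa_fps = (dil 2 xi_fps * (1 + sigma)) ^ 5"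
proof -
  let ?t = "dil 2 xi_fps * (1 + sigma)"
  have "(e 4 ^ 3 * e 2) * (?t * (e 1 * e 6 ^ 7))
      = (dil 2 xi_fps * (e 2 * e 6 ^ 5)) * (e 1 * e 4 ^ 3 * e 6 ^ 2 * (1 + sigma))" by algebra
  also have "\<dots> = (e 4 ^ 3 * e 2) * (e 2 * e 3 ^ 3 * e 4 ^ 2 * e 12 ^ 2)"
    unfolding dil_xi_eq one_plus_sigma by algebra
  finally have t: "?t * (e 1 * e 6 ^ 7) = e 2 * e 3 ^ 3 * e 4 ^ 2 * e 12 ^ 2"
    by (subst (asm) mult_cancel_left) simp
  let ?D = "e 3 ^ 15 * (e 1 * e 6 ^ 7) ^ 5 "
  have "?D * (gamma_fps * ?t ^ 5) = (gamma_fps * e 3 ^ 15) * (?t * (e 1 * e 6 ^ 7)) ^ 5"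
    by (simp only: power_mult_distrib mult_ac)
  also have "\<dots> = e 1 ^ 5 * e 6 ^ 5 * e 3 ^ 15 * (e 2 ^ 5 * e 4 ^ 5 * e 12 ^ 5) ^ 2"
    unfolding t gamma_eq by (simp only: power_mult_distrib mult_ac flip: power_mult) (simp flip: power_add mult.assoc)
  also have "\<dots> = ?D * dil 2 gamma_fps ^ 2"
    unfolding dil_gamma_eq[symmetric] by algebra
  finally have *: "gamma_fps * ?t ^ 5 = dil 2 gamma_fps ^ 2"
    by (subst (asm) mult_cancel_left) simp
  then show ?thesis
    unfolding kappa_fps_def *[symmetric] using gamma_nth_0 by (metis nonzero_mult_div_cancel_left fps_zero_nth zero_neq_one)
qed

definition chi :: "rat fps" where
  "chi = fps_X * rho ^ 2"

lemma sigma_square: "sigma ^ 2 = dil 2 chi"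
  by (simp add: sigma_def chi_def dil_hom dil_X power2_eq_square mult_ac)

text \<open>The relation \<open>dil_xi_sigma\<close> involves only q^2, so injectivity of
  \<open>dil 2\<close> lets it descend to q.\<close>

lemma xi_chi: "xi_fps * (1 - chi) = 1"
proof (rule inj_dil)
  have "dil 2 xi_fps * (1 - sigma ^ 2) = dil 2 xi_fps * ((1 + sigma) * (1 - sigma))" by algebra
  then show "dil 2 (xi_fps * (1 - chi)) = dil 2 1"
    by (simp add: dil_hom dil_xi_sigma flip: sigma_square)
qed simp

lemma xi_neq_1: "xi_fps \<noteq> 1"
proof
  assume "xi_fps = 1"
  then have "rho = 0" using xi_chi by (simp add: chi_def)
  then show False using rho_eq by simp
qed

text \<open>The parts of (1 + s)^n (1 + 3s) even and odd in s, the latter divided by s, with q^2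
  replaced by q so that \<open>chi\<close> stands for s^2. The recursion is multiplication by 1 +
  s.\<close>

fun even_part odd_part :: "nat \<Rightarrow> rat fps" where
  "even_part 0 = 1"
| "even_part (Suc n) = even_part n + chi * odd_part n"
| "odd_part 0 = 3"
| "odd_part (Suc n) = even_part n + odd_part n"

lemma binomial_parts:
  "(1 + sigma) ^ n * (1 + 3 * sigma) = dil 2 (even_part n) + sigma * dil 2 (odd_part n)"
proof (induction n)
  case 0
  then show ?case by (simp add: dil_hom dil_numeral)
next
  case (Suc n)
  have "(1 + sigma) ^ Suc n * (1 + 3 * sigma) = (1 + sigma) * (dil 2 (even_part n) + sigma * dil 2 (odd_part n))"
    using Suc by (simp add: mult.assoc)
  also have "\<dots> = dil 2 (even_part n) + sigma ^ 2 * dil 2 (odd_part n)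
      + sigma * (dil 2 (even_part n) + dil 2 (odd_part n))" by algebra
  finally show ?case by (simp add: dil_hom sigma_square)
qed

text \<open>A factor \<open>dil 2 f\<close> passes through \<open>U\<close>, and the odd part is
  \<open>fps_X\<close> times a series in q^2, which \<open>U\<close> annihilates.\<close>

lemma U_binomial:
  "U (dil 2 f * ((1 + sigma) ^ n * (1 + 3 * sigma))) = f * even_part n"
proof -
  have "dil 2 f * ((1 + sigma) ^ n * (1 + 3 * sigma))
      = dil 2 (f * even_part n) + fps_X * dil 2 (f * rho * odd_part n)"
    unfolding binomial_parts by (simp add: dil_hom sigma_def algebra_simps)
  then show ?thesis by (simp only: U_add U_dil U_X_dil add_0_right)
qed

text \<open>The three-term recurrence comes from (1 + s)^2 = 2(1 + s) - (1 - s^2), where 1 -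
  \<open>chi\<close> is the inverse of \<xi>.\<close>

lemma even_part_zpoly:
  "xi_fps ^ (Suc n div 2) * even_part n = poly_in_xi (zpoly n)"
proof (induction n rule: zpoly.induct)
  case 1
  then show ?case by (simp add: poly_in_xi_def)
next
  case 2
  have "xi_fps * (1 + chi * 3) = 4 * xi_fps - 3 * (xi_fps * (1 - chi))" by algebra
  then have "xi_fps * (1 + chi * 3) = 4 * xi_fps - 3" by (simp only: xi_chi mult_1_right)
  moreover have "poly_in_xi [:- 3, 4:] = 4 * xi_fps - 3"
    by (simp add: poly_in_xi_pCons numeral_fps_const mult.commute flip: fps_const_neg)
  ultimately show ?case by simp
next
  case (3 n)
  have rec: "xi_fps * even_part (Suc (Suc n)) = xi_fps * 2 * even_part (Suc n) - (xi_fps * (1 - chi)) * even_part n"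
    by (simp add: algebra_simps)
  have pow: "xi_fps ^ (Suc (Suc (Suc n)) div 2) = xi_fps ^ (Suc n div 2) * xi_fps" by simp
  have "xi_fps ^ (Suc (Suc (Suc n)) div 2) * even_part (Suc (Suc n))
      = xi_fps ^ (Suc n div 2) * (xi_fps * even_part (Suc (Suc n)))"
    unfolding pow by (simp only: mult.assoc)
  also have "\<dots> = 2 * (xi_fps * xi_fps ^ (Suc n div 2) * even_part (Suc n)) - poly_in_xi (zpoly n)"
    unfolding rec xi_chi 3(3)[symmetric] by algebra
  also have "\<dots> = poly_in_xi (zpoly (Suc (Suc n)))"
  \<comment> \<open>From \<open>n\<close> to \<open>n + 1\<close> the normalising exponent grows for
    even \<open>n\<close>, absorbing the extra \<xi>; for odd \<open>n\<close> it stays, and the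
    \<xi> left over is the \<open>pCons 0\<close> in \<open>zpoly\<close>.\<close>
  proof (cases "even n")
    case True
    then have "xi_fps * xi_fps ^ (Suc n div 2) = xi_fps ^ (Suc (Suc n) div 2)" by simp
    then show ?thesis using True 3(1)
      by (simp add: poly_in_xi_diff poly_in_xi_smult numeral_fps_const del: even_part.simps)
  next
    case False
    then have "xi_fps * xi_fps ^ (Suc n div 2) = xi_fps * xi_fps ^ (Suc (Suc n) div 2)" by simp
    then show ?thesis using False 3(2)
      by (simp add: poly_in_xi_diff poly_in_xi_smult poly_in_xi_pCons numeral_fps_const mult_ac del: even_part.simps)
  qed
  finally show ?case .
qed

text \<open>Here 5i - 2 = -2, and the negative power is removed by (1 + s)^(-2) = \<xi>(q^2)^2 (1 -
  s)^2.\<close>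

lemma zeta_0: "zeta 0 1 = poly_in_xi (monom 1 1 * [:5, - 4:])"
proof -
  have "xi_fps = (dil 2 xi_fps * ((1 + sigma) * (1 - sigma))) ^ 2 * xi_fps"
    by (simp add: dil_xi_sigma)
  also have "\<dots> = dil 2 xi_fps ^ 2 * ((1 - sigma) ^ 2 * (xi_fps * (1 + sigma) ^ 2))"
    by algebra
  also have "\<dots> = dil 2 xi_fps ^ 2 * (1 - 5 * sigma ^ 2) + sigma * (dil 2 xi_fps ^ 2 * (1 + 3 * sigma ^ 2))"
    unfolding xi_sigma by algebra
  also have "\<dots> = dil 2 (xi_fps ^ 2 * (1 - 5 * chi)) + fps_X * dil 2 (rho * (xi_fps ^ 2 * (1 + 3 * chi)))"
    unfolding sigma_square by (simp add: dil_hom dil_numeral sigma_def mult_ac)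
  finally have "U xi_fps = U \<dots>" by (rule arg_cong)
  then have "zeta 0 1 = xi_fps ^ 2 * (1 - 5 * chi)"
    by (simp only: zeta_def U_add U_dil U_X_dil power_0 power_one_right mult_1_left add_0_right)
  also have "\<dots> = 5 * xi_fps * (xi_fps * (1 - chi)) - 4 * xi_fps ^ 2" by algebra
  also have "\<dots> = 5 * xi_fps - 4 * xi_fps ^ 2" by (simp only: xi_chi mult_1_right)
  also have "\<dots> = poly_in_xi (monom 1 1 * [:5, - 4:])"
    unfolding poly_in_xi_monom_mult
    by (simp add: poly_in_xi_pCons algebra_simps power2_eq_square numeral_fps_const flip: fps_const_neg)
  finally show ?thesis .
qed

lemma zeta_pos:
  assumes "i > 0"
  shows "zeta i 1 = poly_in_xi (monom 1 (d i 1) * zpoly (5 * i - 2))"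
proof -
  define n where "n = 5 * i - 2"
  \<comment> \<open>Two of the factors 1 + s are reserved for turning \<xi> into 1 + 3s.\<close>
  have n: "5 * i = n + 2" using assms by (simp add: n_def)
  \<comment> \<open>\<open>d i 1\<close> is what remains of the power 5i of \<xi> after
    \<open>zpoly n\<close> has absorbed its share.\<close>
  have d: "5 * i = d i 1 + Suc n div 2"
  proof (cases "even i")
    case True
    then obtain I where "i = 2 * I" by (elim evenE)
    then show ?thesis using assms by (simp add: d_def n_def)
  next
    case False
    then obtain I where "i = 2 * I + 1" by (elim oddE)
    then show ?thesis by (simp add: d_def n_def)
  qed
  have "kappa_fps ^ i * xi_fps ^ 1 = dil 2 xi_fps ^ (5 * i) * ((1 + sigma) ^ (5 * i) * xi_fps)"
    unfolding kappa_eq by (simp add: power_mult_distrib mult.assoc flip: power_mult)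
  also have "(1 + sigma) ^ (5 * i) * xi_fps = (1 + sigma) ^ n * (xi_fps * (1 + sigma) ^ 2)"
    unfolding n power_add by (simp only: mult_ac)
  finally have "zeta i 1 = xi_fps ^ (5 * i) * even_part n"
    unfolding zeta_def xi_sigma by (simp add: U_binomial flip: dil_hom(4))
  also have "\<dots> = xi_fps ^ d i 1 * poly_in_xi (zpoly n)"
    unfolding d power_add even_part_zpoly[symmetric] by (simp only: mult.assoc)
  finally show ?thesis by (simp only: poly_in_xi_monom_mult n_def)
qed

theorem theorem4p3:
  fixes i :: nat
  shows "(\<exists>!p. zeta i 1 = poly_in_xi p) \<and>
         nu (Z i 1 (d i 1)) = 0 \<and>
         (if i mod 4 = 1 then nu (Z i 1 (d i 1 + 1)) = 1
                         else nu (Z i 1 (d i 1 + 1)) \<ge> 2) \<and>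
         (\<forall>M::nat. M \<ge> 2 \<longrightarrow> nu (Z i 1 (d i 1 + M)) \<ge> enat M + 1)"
  by (rule valuations_of_Z[OF inj_poly_in_xi[OF xi_nth_0 xi_neq_1] zeta_0 zeta_pos])

end
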